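(* Let $K/k$ be a quadratic field extension, let $(B,\sigma)$ be a central division algebra of degree $3$ over $K$ with a unitary involution $\sigma$ over $K/k$, and let $p\in SU(B,\sigma)$. Let $J(B,\sigma,u,\mu)$ be a second Tits construction Albert algebra over $k$. Then the automorphism $\phi_p:J(B,\sigma,u,\mu)\to J(B,\sigma,u,\mu)$, $\phi_p(a,b)=(pa\sigma(p),pb)$, is inner.
   Context: Let $n$ and $t$ be the reduced norm and trace of $B$, with reduced characteristic polynomial $X^3-t(y)X^2+s(y)X-n(y)$, and put $y^{\#}=y^2-t(y)y+s(y)1$. Let $\mu\mapsto\overline{\mu}$ be the nontrivial $k$-automorphism of $K$ ($K/k$ separable, $\sigma|_K$ is the bar). $SU(B,\sigma)=\{x\in B: x\sigma(x)=1,\ n(x)=1\}$ and $\mathcal{H}(B,\sigma)=\{b\in B:\sigma(b)=b\}$. Second Tits construction. Let $u\in B^*$ with $\sigma(u)=u$ and $\mu\in K^*$ with $n(u)=\mu\overline{\mu}$. Then $A=J(B,\sigma,u,\mu)=\mathcal{H}(B,\sigma)\oplus B$ is the Albert algebra over $k$ with identity $(1,0)$, norm $N(a_0,a)=n(a_0)+\mu n(a)+\overline{\mu}n(\sigma(a))-t(a_0au\sigma(a))$, adjoint $(a_0,a)^{\#}=(a_0^{\#}-au\sigma(a),\ \overline{\mu}\sigma(a)^{\#}u^{-1}-a_0a)$ and trace bilinear form $T((a_0,a),(b_0,b))=t(a_0b_0)+t(au\sigma(b))+\overline{t(au\sigma(b))}$. Put $x\times y=(x+y)^{\#}-x^{\#}-y^{\#}$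 and $U_x(y)=T(x,y)x-x^{\#}\times y$. An element $a\in A$ is invertible if $N(a)\neq0$. $Aut(A)$ is the group of $k$-linear bijections preserving $1,N,\#,T$. $Instr(A)$ is the group of linear bijections of $A$ generated by the $U_a$, $a\in A$ invertible. An automorphism of $A$ is inner if it lies in $Aut(A)\cap Instr(A)$. *)

theory Defs
  imports
    "HOL-Analysis.Analysis"
    "HOL-Algebra.Algebraic_Closure_Type"
    "HOL-Algebra.Bij"
    "HOL-Algebra.Generated_Groups"
begin

text \<open>
  The fields \<open>k\<close>, \<open>K\<close> and the division algebra \<open>B\<close> are types; the inclusions \<open>k \<subseteq> K \<subseteq> B\<close> are
  injections \<open>\<iota> : k \<rightarrow> K\<close> and \<open>\<kappa> : K \<rightarrow> B\<close>.  Injectivity is automatic for unital ring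
  homomorphisms out of a field.
\<close>

definition unital_ring_hom :: "('a::ring_1 \<Rightarrow> 'b::ring_1) \<Rightarrow> bool" where
  "unital_ring_hom f \<longleftrightarrow>
     f 1 = 1 \<and> (\<forall>x y. f (x + y) = f x + f y) \<and> (\<forall>x y. f (x * y) = f x * f y)"

text \<open>
  A quadratic extension with a nontrivial \<open>k\<close>-automorphism is separable, and \<open>bar\<close> is then the
  only nontrivial automorphism; its fixed field is the image of \<open>\<iota>\<close>.  A nonzero value of
  \<open>dim\<close> entails finite dimension.
\<close>

locale separable_quadratic_extension =
  fixes \<iota> :: "'k::field \<Rightarrow> 'K::field" and bar :: "'K \<Rightarrow> 'K"
  assumes \<iota>_hom: "unital_ring_hom \<iota>"
    and quadratic: "vector_space.dim (\<lambda>c x. \<iota> c * x) (UNIV :: 'K set) = 2"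
    and bar_hom: "unital_ring_hom bar"
    and bar_bij: "bij bar"
    and bar_fixes_k: "\<And>c. bar (\<iota> c) = \<iota> c"
    and bar_nontrivial: "bar \<noteq> id"

locale central_division_algebra =
  fixes \<kappa> :: "'K::field \<Rightarrow> 'b::division_ring" and degree :: nat
  assumes \<kappa>_hom: "unital_ring_hom \<kappa>"
    and center: "range \<kappa> = {z. \<forall>x. z * x = x * z}"
    and dim_degree: "vector_space.dim (\<lambda>c x. \<kappa> c * x) (UNIV :: 'b set) = degree ^ 2"

subsection \<open>Reduced characteristic polynomial in degree 3\<close>

text \<open>
  A \<open>K\<close>-algebra homomorphism \<open>\<rho>\<close> from \<open>B\<close> to the 3 by 3 matrices over the algebraic closure \<open>L\<close>
  of \<open>K\<close> is the same as an \<open>L\<close>-algebra homomorphism from the scalar extension of \<open>B\<close> to \<open>L\<close>.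
  The last conjunct says that the latter is onto, hence (both sides having dimension 9) that it
  is an isomorphism.
\<close>

definition splitting :: "('K::field \<Rightarrow> 'b::division_ring) \<Rightarrow> ('b \<Rightarrow> 'K alg_closure ^ 3 ^ 3) \<Rightarrow> bool" where
  "splitting \<kappa> \<rho> \<longleftrightarrow>
     (\<forall>c. \<rho> (\<kappa> c) = mat (to_ac c)) \<and>
     (\<forall>x y. \<rho> (x + y) = \<rho> x + \<rho> y) \<and>
     (\<forall>x y. \<rho> (x * y) = \<rho> x ** \<rho> y) \<and>
     module.span (\<lambda>c M. mat c ** M) (range \<rho>) = UNIV"

definition matrix_char_poly :: "'a::comm_ring_1 ^ 'n ^ 'n \<Rightarrow> 'a poly" where
  "matrix_char_poly M = det (mat [:0, 1:] - (\<chi> i j. [:M $ i $ j:]))"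

definition red_char_poly :: "('K::field \<Rightarrow> 'b::division_ring) \<Rightarrow> 'b \<Rightarrow> 'K poly" where
  "red_char_poly \<kappa> y =
     (THE q. \<exists>\<rho>. splitting \<kappa> \<rho> \<and> map_poly to_ac q = matrix_char_poly (\<rho> y))"

text \<open>The reduced characteristic polynomial is \<open>X^3 - trd y X^2 + srd y X - nrd y\<close>.\<close>

definition trd :: "('K::field \<Rightarrow> 'b::division_ring) \<Rightarrow> 'b \<Rightarrow> 'K" where
  "trd \<kappa> y = - poly.coeff (red_char_poly \<kappa> y) 2"

definition srd :: "('K::field \<Rightarrow> 'b::division_ring) \<Rightarrow> 'b \<Rightarrow> 'K" where
  "srd \<kappa> y = poly.coeff (red_char_poly \<kappa> y) 1"

definition nrd :: "('K::field \<Rightarrow> 'b::division_ring) \<Rightarrow> 'b \<Rightarrow> 'K" where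
  "nrd \<kappa> y = - poly.coeff (red_char_poly \<kappa> y) 0"

definition adj :: "('K::field \<Rightarrow> 'b::division_ring) \<Rightarrow> 'b \<Rightarrow> 'b" where
  "adj \<kappa> y = y ^ 2 - \<kappa> (trd \<kappa> y) * y + \<kappa> (srd \<kappa> y)"

subsection \<open>Unitary involutions\<close>

locale unitary_division_algebra =
  separable_quadratic_extension \<iota> bar + central_division_algebra \<kappa> 3
  for \<iota> :: "'k::field \<Rightarrow> 'K::field" and bar :: "'K \<Rightarrow> 'K"
    and \<kappa> :: "'K \<Rightarrow> 'b::division_ring" +
  fixes \<sigma> :: "'b \<Rightarrow> 'b"
  assumes \<sigma>_add: "\<And>x y. \<sigma> (x + y) = \<sigma> x + \<sigma> y"
    and \<sigma>_mult: "\<And>x y. \<sigma> (x * y) = \<sigma> y * \<sigma> x"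
    and \<sigma>_invol: "\<And>x. \<sigma> (\<sigma> x) = x"
    and \<sigma>_\<kappa>: "\<And>c. \<sigma> (\<kappa> c) = \<kappa> (bar c)"

definition SU :: "('K::field \<Rightarrow> 'b::division_ring) \<Rightarrow> ('b \<Rightarrow> 'b) \<Rightarrow> 'b set" where
  "SU \<kappa> \<sigma> = {x. x * \<sigma> x = 1 \<and> nrd \<kappa> x = 1}"

definition Herm :: "('b \<Rightarrow> 'b) \<Rightarrow> 'b set" where
  "Herm \<sigma> = {b. \<sigma> b = b}"

subsection \<open>The second Tits construction\<close>

locale second_tits_construction = unitary_division_algebra \<iota> bar \<kappa> \<sigma>
  for \<iota> :: "'k::field \<Rightarrow> 'K::field" and bar :: "'K \<Rightarrow> 'K"
    and \<kappa> :: "'K \<Rightarrow> 'b::division_ring" and \<sigma> :: "'b \<Rightarrow> 'b" +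
  fixes u :: 'b and \<mu> :: 'K
  assumes u_nonzero: "u \<noteq> 0"
    and u_herm: "\<sigma> u = u"
    and \<mu>_nonzero: "\<mu> \<noteq> 0"
    and nrd_u: "nrd \<kappa> u = \<mu> * bar \<mu>"
begin

definition J :: "('b \<times> 'b) set" where
  "J = Herm \<sigma> \<times> UNIV"

definition J_one :: "'b \<times> 'b" where
  "J_one = (1, 0)"

text \<open>
  On \<open>J\<close> the norm and the trace form take values in \<open>k\<close>, regarded as a subfield of \<open>K\<close>.
\<close>

definition J_norm :: "'b \<times> 'b \<Rightarrow> 'K" where
  "J_norm = (\<lambda>(a0, a). nrd \<kappa> a0 + \<mu> * nrd \<kappa> a + bar \<mu> * nrd \<kappa> (\<sigma> a)
                        - trd \<kappa> (a0 * a * u * \<sigma> a))"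

definition J_adj :: "'b \<times> 'b \<Rightarrow> 'b \<times> 'b" where
  "J_adj = (\<lambda>(a0, a). (adj \<kappa> a0 - a * u * \<sigma> a,
                       \<kappa> (bar \<mu>) * adj \<kappa> (\<sigma> a) * inverse u - a0 * a))"

definition J_trace :: "'b \<times> 'b \<Rightarrow> 'b \<times> 'b \<Rightarrow> 'K" where
  "J_trace = (\<lambda>(a0, a) (b0, b). trd \<kappa> (a0 * b0) + trd \<kappa> (a * u * \<sigma> b)
                                 + bar (trd \<kappa> (a * u * \<sigma> b)))"

definition J_cross :: "'b \<times> 'b \<Rightarrow> 'b \<times> 'b \<Rightarrow> 'b \<times> 'b" where
  "J_cross x y = J_adj (x + y) - J_adj x - J_adj y"

definition J_scale :: "'K \<Rightarrow> 'b \<times> 'b \<Rightarrow> 'b \<times> 'b" where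
  "J_scale c = (\<lambda>(a0, a). (\<kappa> c * a0, \<kappa> c * a))"

definition U :: "'b \<times> 'b \<Rightarrow> 'b \<times> 'b \<Rightarrow> 'b \<times> 'b" where
  "U x y = J_scale (J_trace x y) x - J_cross (J_adj x) y"

text \<open>
  Self-maps of \<open>J\<close> are represented by functions that are \<open>undefined\<close> outside \<open>J\<close>.
\<close>

definition GL_J :: "('b \<times> 'b \<Rightarrow> 'b \<times> 'b) monoid" where
  "GL_J = (BijGroup J)\<lparr>carrier :=
     {f \<in> Bij J. (\<forall>x\<in>J. \<forall>y\<in>J. f (x + y) = f x + f y) \<and>
                 (\<forall>c. \<forall>x\<in>J. f (J_scale (\<iota> c) x) = J_scale (\<iota> c) (f x))}\<rparr>"

definition Aut_J :: "('b \<times> 'b \<Rightarrow> 'b \<times> 'b) set" where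
  "Aut_J = {f \<in> carrier GL_J.
     f J_one = J_one \<and>
     (\<forall>x\<in>J. J_norm (f x) = J_norm x) \<and>
     (\<forall>x\<in>J. f (J_adj x) = J_adj (f x)) \<and>
     (\<forall>x\<in>J. \<forall>y\<in>J. J_trace (f x) (f y) = J_trace x y)}"

definition Instr_J :: "('b \<times> 'b \<Rightarrow> 'b \<times> 'b) set" where
  "Instr_J = generate GL_J {restrict (U a) J | a. a \<in> J \<and> J_norm a \<noteq> 0}"

definition inner_automorphism :: "('b \<times> 'b \<Rightarrow> 'b \<times> 'b) \<Rightarrow> bool" where
  "inner_automorphism f \<longleftrightarrow> f \<in> Aut_J \<inter> Instr_J"

definition \<phi> :: "'b \<Rightarrow> 'b \<times> 'b \<Rightarrow> 'b \<times> 'b" where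
  "\<phi> p = (\<lambda>(a, b)\<in>J. (p * a * \<sigma> p, p * b))"

end

end

theory Submission
  imports Defs
begin

text \<open>
  For a nonzero Hermitian element \<open>h\<close> of \<open>B\<close> the operator \<open>U\<close> of \<open>(h, 0)\<close> sends \<open>(a, b)\<close> to
  \<open>(h a h, n(h) inverse h b)\<close>.  Composing such operators gives, for every product \<open>w\<close> of nonzero
  Hermitian elements, the map \<open>(a, b) \<mapsto> (w a \<sigma>(w), n(w) inverse (\<sigma>(w)) b)\<close>.  If \<open>w\<close> lies in \<open>SU\<close>, then
  \<open>n(w) = 1\<close> and \<open>inverse (\<sigma>(w)) = w\<close>, so this map is \<open>\<phi> w\<close>, which preserves the Albert algebra structure
  because reduced norm, trace and adjoint are compatible with conjugation by \<open>w\<close> (\<open>\<phi>_Aut\<close>).  The theorem follows because every element of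
  reduced norm 1 is a product of Hermitian elements (\<open>norm_one_in_herm_products\<close>).  Two facts prove
  this.

  First, an element \<open>p\<close> of reduced norm 1 outside the centre is a commutator
  (\<open>noncentral_norm_one_is_commutator\<close>).  Wedderburn's factorization of the cubic polynomial of \<open>p\<close>
  gives conjugates with \<open>p3 p2 p = 1\<close> and an element \<open>x\<close> whose conjugation permutes
  \<open>p, p2, p3\<close> cyclically; then \<open>x\<^sup>3\<close> is central.  Writing \<open>p = x v\<close>, the product becomes
  \<open>x\<^sup>3 v\<^sup>3 = 1\<close>, so \<open>x\<close> and \<open>inverse v\<close> have the same central cube, hence are conjugate, and
  \<open>p = x v\<close> is a commutator.

  Second, products of Hermitian elements form a normal subgroup containing all commutators
  (\<open>commutator_in_herm_products\<close>).  By linear algebra over \<open>K\<close>, for given \<open>x\<close> and \<open>y\<close> some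
  Hermitian \<open>h \<noteq> 0\<close> has \<open>x h\<close> Hermitian, or some Hermitian \<open>h\<close> has \<open>x h = y + g\<close> with \<open>g\<close>
  Hermitian.  Modulo the subgroup \<open>x\<close> becomes trivial, or (when \<open>g = 0\<close>) equal to \<open>y\<close>, or equal to
  \<open>inverse g y + 1\<close>, which commutes with \<open>inverse g y\<close>, an element congruent to \<open>y\<close>.

  The reduced characteristic polynomial is defined through splittings, so its formal properties
  need a splitting to exist and its coefficients to lie in \<open>K\<close> and not to depend on the splitting
  (\<open>scalar_hom_exists\<close>, \<open>red_char_poly_eq\<close>).  Both rest on two facts: a \<open>K\<close>-algebra homomorphism
  from \<open>B\<close> to matrices over the closure preserves linear independence (\<open>hom_independent\<close>), and
  a noncentral element has a commutative centralizer of dimension 3 (\<open>centralizer_eq_span\<close>),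
  because dimensions of subalgebras divide 9.
\<close>

section \<open>Three by three matrices\<close>

\<comment> \<open>The dollar sign denotes matrix entries only, not coefficients of power series.\<close>
no_notation fps_nth (infixl \<open>$\<close> 75)

definition minors_sum :: "'a::comm_ring_1 ^ 3 ^ 3 \<Rightarrow> 'a" where
  "minors_sum M = M$1$1 * M$2$2 - M$1$2 * M$2$1 + M$1$1 * M$3$3 - M$1$3 * M$3$1
                + M$2$2 * M$3$3 - M$2$3 * M$3$2"

lemmas matrix_3_simps =
  vec_eq_iff forall_3 matrix_matrix_mult_def sum_3 mat_def trace_def minors_sum_def det_3

lemma det_mat_minus_3:
  fixes M :: "'a::comm_ring_1 ^ 3 ^ 3"
  shows "det (mat x - M) = x ^ 3 - trace M * x\<^sup>2 + minors_sum M * x - det M"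
  by (simp add: matrix_3_simps) (simp add: power2_eq_square power3_eq_cube algebra_simps)

lemma matrix_char_poly_3:
  fixes M :: "'a::comm_ring_1 ^ 3 ^ 3"
  shows "matrix_char_poly M = [:- det M, minors_sum M, - trace M, 1:]"
proof -
  let ?C = "(\<chi> i j. [:M $ i $ j:]) :: 'a poly ^ 3 ^ 3"
  have "trace ?C = [:trace M:]" "minors_sum ?C = [:minors_sum M:]" "det ?C = [:det M:]"
    by (simp_all add: trace_def minors_sum_def det_3 sum_3)
  then show ?thesis
    unfolding matrix_char_poly_def det_mat_minus_3 by (simp add: power2_eq_square power3_eq_cube)
qed

lemma cayley_hamilton_3:
  fixes M :: "'a::comm_ring_1 ^ 3 ^ 3"
  shows "M ** M ** M = mat (trace M) ** (M ** M) - mat (minors_sum M) ** M + mat (det M)"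
  by (simp add: matrix_3_simps) (simp add: algebra_simps)

lemma minors_sum_add:
  fixes A B :: "'a::comm_ring_1 ^ 3 ^ 3"
  shows "minors_sum (A + B) = minors_sum A + minors_sum B + trace A * trace B - trace (A ** B)"
  by (simp add: matrix_3_simps) (simp add: algebra_simps)

text \<open>The part of the Cayley-Hamilton identity for \<open>A + B\<close> that is quadratic in \<open>A\<close> and linear in
  \<open>B\<close>.  It holds entrywise over any commutative ring, so no scalars need to be separated.\<close>

lemma cayley_hamilton_3_linearized:
  fixes A B :: "'a::comm_ring_1 ^ 3 ^ 3"
  shows "A ** A ** B + A ** B ** A + B ** A ** A
    = mat (trace B) ** (A ** A) + mat (trace A) ** (A ** B + B ** A) - mat (minors_sum A) ** B
      - mat (trace A * trace B - trace (A ** B)) ** A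
      + mat (trace (A ** A ** B) - trace A * trace (A ** B) + minors_sum A * trace B)"
  by (simp add: matrix_3_simps) (simp add: algebra_simps)

lemma mat_mult_mat [simp]: "mat a ** (mat b :: 'a::comm_ring_1 ^ 3 ^ 3) = mat (a * b)"
  by (simp add: matrix_3_simps)

lemma mat_mult_nth [simp]: "(mat a ** (M :: 'a::comm_ring_1 ^ 3 ^ 3)) $ i $ j = a * M $ i $ j"
proof -
  have "\<forall>i j. (mat a ** M) $ i $ j = a * M $ i $ j" by (simp add: forall_3 matrix_matrix_mult_def sum_3 mat_def)
  then show ?thesis by blast
qed

lemma mat_eq_0_iff: "(mat a :: 'a::comm_ring_1 ^ 3 ^ 3) = 0 \<longleftrightarrow> a = 0"
  by (auto simp: vec_eq_iff mat_def)

lemma mat_add: "(mat (a + b) :: 'a::comm_ring_1 ^ 3 ^ 3) = mat a + mat b"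
  by (simp add: vec_eq_iff mat_def)

lemma matrix_3_diff_distrib:
  fixes A B C :: "'a::comm_ring_1 ^ 3 ^ 3"
  shows "A ** (B - C) = A ** B - A ** C" "(B - C) ** A = B ** A - C ** A"
  by (simp_all add: vec_eq_iff matrix_matrix_mult_def sum_subtractf algebra_simps)

lemma mat_diff: "(mat (a - b) :: 'a::comm_ring_1 ^ 3 ^ 3) = mat a - mat b"
  by (simp add: vec_eq_iff mat_def)

lemma matrix_mult_sum_right: "(M :: 'a::comm_ring_1 ^ 3 ^ 3) ** sum f A = (\<Sum>i\<in>A. M ** f i)"
  by (induction A rule: infinite_finite_induct) (simp_all add: matrix_add_ldistrib)

lemma matrix_mult_sum_left: "sum f A ** (M :: 'a::comm_ring_1 ^ 3 ^ 3) = (\<Sum>i\<in>A. f i ** M)"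
  by (induction A rule: infinite_finite_induct) (simp_all add: matrix_matrix_mult_def vec_eq_iff sum.distrib algebra_simps)

lemma mat_sum: "(mat (sum f A) :: 'a::comm_ring_1 ^ 3 ^ 3) = (\<Sum>i\<in>A. mat (f i))"
  by (induction A rule: infinite_finite_induct) (simp_all add: mat_add)

lemma mat_left_commute:
  fixes M N :: "'a::comm_ring_1 ^ 3 ^ 3"
  shows "M ** (mat c ** N) = mat c ** (M ** N)"
  by (simp add: vec_eq_iff matrix_matrix_mult_def[of M] sum_distrib_left algebra_simps)

lemma vector_space_matrices: "vector_space (\<lambda>c M. mat c ** (M :: 'a::field ^ 3 ^ 3))"
  by unfold_locales
    (simp_all add: vec_eq_iff algebra_simps)

lemma matrix_units_span:
  "UNIV \<subseteq> module.span (\<lambda>c M. mat c ** M)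
     ((\<lambda>(i, j). \<chi> k l. if k = i \<and> l = j then (1 :: 'a::field) else 0) ` (UNIV :: (3 \<times> 3) set))"
proof
  interpret M: vector_space "\<lambda>c M. mat c ** (M :: 'a ^ 3 ^ 3)" by (rule vector_space_matrices)
  fix A :: "'a ^ 3 ^ 3"
  let ?E = "\<lambda>(i, j). (\<chi> k l. if k = i \<and> l = j then 1 else 0) :: 'a ^ 3 ^ 3"
  have "A = (\<Sum>i\<in>UNIV. \<Sum>j\<in>UNIV. mat (A $ i $ j) ** ?E (i, j))"
    by (simp add: vec_eq_iff forall_3 sum_3)
  also have "\<dots> \<in> M.span (?E ` UNIV)"
    by (intro M.span_sum M.span_scale M.span_base) auto
  finally show "A \<in> M.span (?E ` UNIV)" .
qed

section \<open>Subalgebras and centralizers\<close>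

lemma dvd_9_cases:
  assumes "d dvd (9 :: nat)" shows "d = 1 \<or> d = 3 \<or> d = 9"
proof -
  have "d \<le> 9" using assms by (rule dvd_imp_le) simp
  then have "d \<in> {0,1,2,3,4,5,6,7,8,9}" by (simp add: numeral_eq_Suc le_Suc_eq)
  then show ?thesis using assms by auto
qed

locale cubic_division_algebra = central_division_algebra \<kappa> 3
  for \<kappa> :: "'K::field \<Rightarrow> 'b::division_ring"
begin

lemma \<kappa>_add [simp]: "\<kappa> (x + y) = \<kappa> x + \<kappa> y"
  and \<kappa>_mult [simp]: "\<kappa> (x * y) = \<kappa> x * \<kappa> y"
  and \<kappa>_1 [simp]: "\<kappa> 1 = 1"
  using \<kappa>_hom by (auto simp: unital_ring_hom_def)

lemma \<kappa>_0 [simp]: "\<kappa> 0 = 0"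
  using \<kappa>_add[of 0 0] by (simp del: \<kappa>_add)

lemma \<kappa>_minus [simp]: "\<kappa> (- x) = - \<kappa> x"
  using \<kappa>_add[of "- x" x] by (simp add: eq_neg_iff_add_eq_0 del: \<kappa>_add)

lemma \<kappa>_diff [simp]: "\<kappa> (x - y) = \<kappa> x - \<kappa> y"
  using \<kappa>_add[of x "- y"] by (simp del: \<kappa>_add)

lemma \<kappa>_eq_0_iff [simp]: "\<kappa> x = 0 \<longleftrightarrow> x = 0"
proof
  assume "\<kappa> x = 0"
  show "x = 0"
  proof (rule ccontr)
    assume "x \<noteq> 0"
    then have "\<kappa> x * \<kappa> (inverse x) = 1" by (simp flip: \<kappa>_mult)
    with \<open>\<kappa> x = 0\<close> show False by simp
  qed
qed simp

lemma \<kappa>_inject [simp]: "\<kappa> x = \<kappa> y \<longleftrightarrow> x = y"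
  using \<kappa>_eq_0_iff[of "x - y"] by (simp del: \<kappa>_eq_0_iff)

lemma \<kappa>_commute: "\<kappa> c * x = x * \<kappa> c"
  using center by blast

lemma \<kappa>_left_commute: "x * (\<kappa> c * y) = \<kappa> c * (x * y)"
  by (metis \<kappa>_commute mult.assoc)

lemma in_range_\<kappa>_iff: "z \<in> range \<kappa> \<longleftrightarrow> (\<forall>x. z * x = x * z)"
  using center by simp

sublocale B: vector_space "\<lambda>c x. \<kappa> c * x"
  by unfold_locales (simp_all add: algebra_simps)

\<comment> \<open>As a rewrite rule it would undo the multiplicativity of \<open>\<kappa>\<close> and loop.\<close>
declare B.scale_scale [simp del]

lemma dim_B: "B.dim UNIV = 9"
  using dim_degree by simp

definition B_basis :: "'b set" where
  "B_basis = (SOME Bs. B.independent Bs \<and> B.span Bs = UNIV \<and> card Bs = 9)"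

lemma B_basis: "B.independent B_basis" "B.span B_basis = UNIV" "card B_basis = 9"
proof -
  obtain Bs where Bs: "B.independent Bs" "UNIV \<subseteq> B.span Bs" "card Bs = B.dim UNIV"
    by (rule B.basis_exists[of UNIV])
  then have "B.independent Bs \<and> B.span Bs = UNIV \<and> card Bs = 9"
    by (simp add: dim_B set_eq_subset)
  then have "\<exists>Bs. B.independent Bs \<and> B.span Bs = UNIV \<and> card Bs = 9" by (rule exI)
  then have "B.independent B_basis \<and> B.span B_basis = UNIV \<and> card B_basis = 9"
    unfolding B_basis_def by (rule someI_ex)
  then show "B.independent B_basis" "B.span B_basis = UNIV" "card B_basis = 9" by blast+
qed

sublocale B: finite_dimensional_vector_space "\<lambda>c x. \<kappa> c * x" B_basis
proof
  show "finite B_basis" by (rule card_ge_0_finite) (unfold B_basis(3), simp)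
qed (fact B_basis)+

lemma linear_mult_right: "Vector_Spaces.linear (\<lambda>c x. \<kappa> c * x) (\<lambda>c x. \<kappa> c * x) (\<lambda>x. x * b)"
  unfolding Vector_Spaces.linear_iff using B.vector_space_axioms by (simp add: distrib_right mult.assoc)

lemma linear_mult_left: "Vector_Spaces.linear (\<lambda>c x. \<kappa> c * x) (\<lambda>c x. \<kappa> c * x) (\<lambda>x. b * x)"
  unfolding Vector_Spaces.linear_iff using B.vector_space_axioms by (simp add: distrib_left \<kappa>_left_commute[of b])

lemma dim_image_inj:
  assumes "Vector_Spaces.linear (\<lambda>c x. \<kappa> c * x) (\<lambda>c x. \<kappa> c * x) f" and "inj f"
  shows "B.dim (f ` V) = B.dim V"
proof -
  interpret p: finite_dimensional_vector_space_pair "\<lambda>c x. \<kappa> c * x" B_basis "\<lambda>c x. \<kappa> c * x" B_basis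
    by unfold_locales
  show ?thesis using p.dim_image_eq[of f V] assms by (meson inj_on_subset subset_UNIV)
qed

lemma subspace_image:
  assumes "Vector_Spaces.linear (\<lambda>c x. \<kappa> c * x) (\<lambda>c x. \<kappa> c * x) f" and "B.subspace V"
  shows "B.subspace (f ` V)"
proof -
  interpret l: Vector_Spaces.linear "\<lambda>c x. \<kappa> c * x" "\<lambda>c x. \<kappa> c * x" f by fact
  show ?thesis using assms(2) by (rule l.subspace_image)
qed

lemma subspace_right_translate: "B.subspace M \<Longrightarrow> B.subspace ((\<lambda>m. m * b) ` M)"
  by (rule subspace_image[OF linear_mult_right])

lemma dim_right_translate: "b \<noteq> 0 \<Longrightarrow> B.dim ((\<lambda>m. m * b) ` M) = B.dim M"
  by (rule dim_image_inj[OF linear_mult_right]) (simp add: inj_on_def)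

text \<open>Left multiplication by \<open>m\<close> is injective, so it permutes a finite-dimensional subspace that
  it maps to itself; in particular multiplicatively closed subspaces are division algebras.\<close>

lemma left_mult_stable_cancel:
  assumes W: "B.subspace W" "\<And>w. w \<in> W \<Longrightarrow> m * w \<in> W" and m: "m \<noteq> 0" "m * b \<in> W"
  shows "b \<in> W"
proof -
  have "inj ((*) m)" using m by (simp add: inj_on_def)
  have "B.dim ((*) m ` W) = B.dim W"
    by (rule dim_image_inj[OF linear_mult_left \<open>inj ((*) m)\<close>])
  moreover have "B.subspace ((*) m ` W)" by (rule subspace_image[OF linear_mult_left W(1)])
  moreover have "(*) m ` W \<subseteq> W" using W(2) by auto
  ultimately have "(*) m ` W = W"
    using B.subspace_dim_equal[of "(*) m ` W" W] W(1) by simp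
  with m(2) have "m * b \<in> (*) m ` W" by simp
  then obtain w where "w \<in> W" "m * b = m * w" by (rule imageE)
  then show ?thesis using m(1) by simp
qed

text \<open>One step in building \<open>B\<close> as a direct sum of translates of \<open>M\<close>.\<close>

definition add_translate :: "'b set \<Rightarrow> 'b set \<Rightarrow> 'b \<Rightarrow> 'b set" where
  "add_translate M W b = {x + y | x y. x \<in> W \<and> y \<in> (\<lambda>m. m * b) ` M}"

lemma add_translate:
  assumes M: "B.subspace M" "\<And>m m'. m \<in> M \<Longrightarrow> m' \<in> M \<Longrightarrow> m * m' \<in> M"
    and W: "B.subspace W" "\<And>m w. m \<in> M \<Longrightarrow> w \<in> W \<Longrightarrow> m * w \<in> W"
    and b: "b \<notin> W"
  shows "B.subspace (add_translate M W b)"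
    and "\<And>m w. m \<in> M \<Longrightarrow> w \<in> add_translate M W b \<Longrightarrow> m * w \<in> add_translate M W b"
    and "B.dim (add_translate M W b) = B.dim W + B.dim M"
    and "W \<inter> (\<lambda>m. m * b) ` M = {0}"
proof -
  let ?Mb = "(\<lambda>m. m * b) ` M"
  have "b \<noteq> 0" using b B.subspace_0[OF W(1)] by auto
  have sMb: "B.subspace ?Mb" by (rule subspace_right_translate[OF M(1)])
  show "B.subspace (add_translate M W b)"
    unfolding add_translate_def by (rule B.subspace_sums[OF W(1) sMb])
  show "m * w \<in> add_translate M W b" if mw: "m \<in> M" "w \<in> add_translate M W b" for m w
  proof -
    obtain x m' where w: "x \<in> W" "m' \<in> M" "w = x + m' * b"
      using mw(2) unfolding add_translate_def by auto
    have "m * w = m * x + (m * m') * b" using w(3) by (simp add: distrib_left mult.assoc)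
    then show ?thesis unfolding add_translate_def using M(2)[OF mw(1) w(2)] W(2)[OF mw(1) w(1)] by auto
  qed
  show int: "W \<inter> ?Mb = {0}"
  proof (intro equalityI subsetI)
    fix x assume x: "x \<in> W \<inter> ?Mb"
    then obtain m where m: "m \<in> M" "x = m * b" by auto
    have "m = 0"
    proof (rule ccontr)
      assume "m \<noteq> 0"
      then have "b \<in> W" using left_mult_stable_cancel[OF W(1)] W(2) m x by blast
      with b show False by simp
    qed
    then show "x \<in> {0}" using m by simp
  next
    fix x assume "x \<in> {0::'b}"
    then show "x \<in> W \<inter> ?Mb" using B.subspace_0[OF W(1)] B.subspace_0[OF sMb] by simp
  qed
  have "B.dim (add_translate M W b) + B.dim (W \<inter> ?Mb) = B.dim W + B.dim ?Mb"
    unfolding add_translate_def by (rule B.dim_sums_Int[OF W(1) sMb])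
  then show "B.dim (add_translate M W b) = B.dim W + B.dim M"
    using dim_right_translate[OF \<open>b \<noteq> 0\<close>, of M] int by simp
qed

text \<open>\<open>B\<close> is a direct sum of translates \<open>M * b\<close>: as long as the sum of those chosen so far is not all
  of \<open>B\<close>, any element outside it contributes a further translate, of the dimension of \<open>M\<close>.\<close>

lemma dim_subalgebra_dvd:
  assumes M: "B.subspace M" "\<And>m m'. m \<in> M \<Longrightarrow> m' \<in> M \<Longrightarrow> m * m' \<in> M"
    and nz: "a \<in> M" "a \<noteq> 0"
  shows "B.dim M dvd 9"
proof -
  have False: "B.dim M \<noteq> 0" using nz by (auto simp: B.dim_eq_0)
  have "B.dim M dvd 9"
    if "B.subspace W" "\<And>m w. m \<in> M \<Longrightarrow> w \<in> W \<Longrightarrow> m * w \<in> W" "B.dim M dvd B.dim W" for W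
    using that
  proof (induction "9 - B.dim W" arbitrary: W rule: less_induct)
    case less
    show ?case
    proof (cases "W = UNIV")
      case True
      then show ?thesis using less.prems(3) dim_B by simp
    next
      case F: False
      then obtain b where b: "b \<notin> W" by auto
      note s = add_translate[OF M less.prems(1,2) b]
      have "B.dim (add_translate M W b) \<le> 9"
        using B.dim_subset_UNIV[of "add_translate M W b"] dim_B by (simp add: B.dimension_def B_basis)
      then have "9 - B.dim (add_translate M W b) < 9 - B.dim W"
        using s(3) False by linarith
      then show ?thesis using less.hyps[OF _ s(1,2)] s(3) less.prems(3) by simp
    qed
  qed
  from this[of "{0}"] show ?thesis by (simp add: B.subspace_single_0)
qed

lemma mem_span_1: "x \<in> B.span {1} \<longleftrightarrow> (\<exists>a. x = \<kappa> a)"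
  by (auto simp: B.span_singleton)

lemma mem_span_2: "x \<in> B.span {z, 1} \<longleftrightarrow> (\<exists>a b. x = \<kappa> a + \<kappa> b * z)"
proof -
  have "x \<in> B.span {z, 1} \<longleftrightarrow> (\<exists>b a. x - \<kappa> b * z = \<kappa> a)"
    by (simp only: B.span_breakdown_eq[of x z "{1}"] mem_span_1)
  also have "\<dots> \<longleftrightarrow> (\<exists>a b. x = \<kappa> a + \<kappa> b * z)"
    by (auto simp: diff_eq_eq)
  finally show ?thesis .
qed

lemma mem_span_3:
  "x \<in> B.span {z\<^sup>2, z, 1} \<longleftrightarrow> (\<exists>a b c. x = \<kappa> a + \<kappa> b * z + \<kappa> c * z\<^sup>2)"
proof -
  have "x \<in> B.span {z\<^sup>2, z, 1} \<longleftrightarrow> (\<exists>c a b. x - \<kappa> c * z\<^sup>2 = \<kappa> a + \<kappa> b * z)"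
    by (simp only: B.span_breakdown_eq[of x "z\<^sup>2" "{z, 1}"] mem_span_2)
  also have "\<dots> \<longleftrightarrow> (\<exists>a b c. x = \<kappa> a + \<kappa> b * z + \<kappa> c * z\<^sup>2)"
    by (auto simp: diff_eq_eq)
  finally show ?thesis .
qed

lemma independent_1_z: "z \<notin> range \<kappa> \<Longrightarrow> B.independent {z, 1}"
proof (rule B.independent_insertI)
  assume "z \<notin> range \<kappa>"
  then show "z \<notin> B.span {1}" by (simp add: mem_span_1 image_iff)
qed (simp only: B.dependent_single one_neq_zero not_False_eq_True)

text \<open>Otherwise the span of \<open>1\<close> and \<open>z\<close> is a subalgebra of dimension 2, which does not divide 9.\<close>

lemma square_notin_span:
  assumes z: "z \<notin> range \<kappa>"
  shows "z\<^sup>2 \<notin> B.span {z, 1}"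
proof
  assume "z\<^sup>2 \<in> B.span {z, 1}"
  then obtain p q where pq: "z * z = \<kappa> p + \<kappa> q * z"
    unfolding mem_span_2 power2_eq_square by blast
  have mult: "m * m' \<in> B.span {z, 1}" if "m \<in> B.span {z, 1}" "m' \<in> B.span {z, 1}" for m m'
  proof -
    obtain a b a' b' where m: "m = \<kappa> a + \<kappa> b * z" "m' = \<kappa> a' + \<kappa> b' * z"
      using \<open>m \<in> _\<close> \<open>m' \<in> _\<close> unfolding mem_span_2 by blast
    have "m * m' = \<kappa> a * \<kappa> a' + \<kappa> a * \<kappa> b' * z + \<kappa> b * \<kappa> a' * z + \<kappa> b * \<kappa> b' * (z * z)"
      unfolding m by (simp add: distrib_left distrib_right mult.assoc add_ac \<kappa>_left_commute[of z] \<kappa>_commute[of _ z, symmetric])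
    also have "\<dots> = \<kappa> (a * a' + b * b' * p) + \<kappa> (a * b' + b * a' + b * b' * q) * z"
      unfolding pq by (simp add: distrib_left distrib_right mult.assoc add_ac)
    finally show ?thesis unfolding mem_span_2 by blast
  qed
  have "B.dim (B.span {z, 1}) dvd 9"
    by (rule dim_subalgebra_dvd[OF B.subspace_span mult B.span_base[of 1]]) simp_all
  moreover have "B.dim (B.span {z, 1}) = 2"
  proof -
    have "z \<noteq> 1" using z \<kappa>_1 by (metis rangeI)
    then show ?thesis using B.dim_span_eq_card_independent[OF independent_1_z[OF z]] by simp
  qed
  ultimately show False by simp
qed

lemma independent_1_z_z2:
  assumes z: "z \<notin> range \<kappa>"
  shows "B.independent {z\<^sup>2, z, 1}" "card {z\<^sup>2, z, 1} = 3"
proof -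
  show "B.independent {z\<^sup>2, z, 1}"
    by (rule B.independent_insertI[OF square_notin_span[OF z] independent_1_z[OF z]])
  have "z \<noteq> 1" using z \<kappa>_1 by (metis rangeI)
  moreover have "z\<^sup>2 \<noteq> z" "z\<^sup>2 \<noteq> 1"
    using square_notin_span[OF z] by (auto intro: B.span_base)
  ultimately show "card {z\<^sup>2, z, 1} = 3" by simp
qed

lemma quadratic_relation_trivial:
  assumes z: "z \<notin> range \<kappa>" and rel: "\<kappa> a + \<kappa> b * z + \<kappa> c * z\<^sup>2 = 0"
  shows "a = 0 \<and> b = 0 \<and> c = 0"
proof -
  have c: "c = 0"
  proof (rule ccontr)
    assume c: "c \<noteq> 0"
    have "\<kappa> c * z\<^sup>2 = - (\<kappa> a + \<kappa> b * z)" using rel by (metis add_eq_0_iff)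
    then have "\<kappa> (inverse c) * (\<kappa> c * z\<^sup>2) = \<kappa> (- (inverse c * a)) + \<kappa> (- (inverse c * b)) * z"
      by (simp add: right_diff_distrib mult.assoc)
    moreover have "\<kappa> (inverse c) * (\<kappa> c * z\<^sup>2) = z\<^sup>2"
      using c by (simp flip: mult.assoc \<kappa>_mult)
    ultimately show False using square_notin_span[OF z] unfolding mem_span_2 by metis
  qed
  have b: "b = 0"
  proof (rule ccontr)
    assume b: "b \<noteq> 0"
    have "\<kappa> b * z = - \<kappa> a" using rel c by (metis add_eq_0_iff \<kappa>_0 add.right_neutral mult_zero_left)
    then have "\<kappa> (inverse b) * (\<kappa> b * z) = \<kappa> (- (inverse b * a))" by simp
    moreover have "\<kappa> (inverse b) * (\<kappa> b * z) = z"
      using b by (simp flip: mult.assoc \<kappa>_mult)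
    ultimately show False using z by (metis rangeI)
  qed
  show ?thesis using rel b c by simp
qed

lemma subspace_centralizer: "B.subspace {x. x * z = z * x}"
  by (rule B.subspaceI) (auto simp: algebra_simps \<kappa>_left_commute[of z])

text \<open>The dimension divides 9, is at least 3 because \<open>1, z, z\<^sup>2\<close> are independent, and is not 9 because
  \<open>z\<close> is not central.\<close>

lemma dim_centralizer:
  assumes z: "z \<notin> range \<kappa>"
  shows "B.dim {x. x * z = z * x} = 3"
proof -
  let ?C = "{x. x * z = z * x}"
  have "B.dim ?C dvd 9"
    by (rule dim_subalgebra_dvd[OF subspace_centralizer, of _ 1]) (auto, metis mult.assoc)
  moreover have "B.dim ?C \<noteq> 9"
  proof
    assume "B.dim ?C = 9"
    then have "?C = UNIV"
      using B.subspace_dim_equal[OF subspace_centralizer B.subspace_UNIV, of z] dim_B by simp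
    then show False using z in_range_\<kappa>_iff by (metis (mono_tags, lifting) UNIV_I mem_Collect_eq)
  qed
  moreover have "3 \<le> B.dim ?C"
    using B.independent_card_le_dim[of "{z\<^sup>2, z, 1}" ?C] independent_1_z_z2[OF z]
    by (simp add: power2_eq_square mult.assoc)
  ultimately show ?thesis using dvd_9_cases by fastforce
qed

text \<open>The polynomials in \<open>z\<close> already fill the three dimensions of the centralizer.\<close>

lemma centralizer_eq_span:
  assumes z: "z \<notin> range \<kappa>"
  shows "{x. x * z = z * x} = B.span {z\<^sup>2, z, 1}"
proof -
  have sub: "{z\<^sup>2, z, 1} \<subseteq> {x. x * z = z * x}" by (auto simp: power2_eq_square mult.assoc)
  have "B.span {z\<^sup>2, z, 1} \<subseteq> {x. x * z = z * x}"
    by (rule B.span_minimal[OF sub subspace_centralizer])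
  moreover have "B.dim (B.span {z\<^sup>2, z, 1}) = 3"
    using B.dim_span_eq_card_independent independent_1_z_z2[OF z] by metis
  ultimately show ?thesis
    using B.subspace_dim_equal[OF B.subspace_span subspace_centralizer, of "{z\<^sup>2, z, 1}" z]
      dim_centralizer[OF z] by simp
qed

lemma commuting_imp_polynomial:
  assumes "z \<notin> range \<kappa>" "x * z = z * x"
  obtains a b c where "x = \<kappa> a + \<kappa> b * z + \<kappa> c * z\<^sup>2"
proof -
  have "x \<in> B.span {z\<^sup>2, z, 1}" using centralizer_eq_span[OF assms(1)] assms(2) by blast
  then show thesis using that unfolding mem_span_3 by blast
qed

text \<open>Everything commuting with \<open>z\<close> is a polynomial in \<open>z\<close>, so two such elements commute.\<close>

lemma commute_trans:
  assumes z: "z \<notin> range \<kappa>" "x * z = z * x" and y: "y * z = z * y"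
  shows "x * y = y * x"
proof -
  obtain a b c where x: "x = \<kappa> a + \<kappa> b * z + \<kappa> c * z\<^sup>2"
    using commuting_imp_polynomial[OF z] .
  have "z\<^sup>2 * y = y * z\<^sup>2" using y by (metis mult.assoc power2_eq_square)
  moreover have "\<kappa> d * w * y = y * (\<kappa> d * w)" if "w * y = y * w" for d w
    using that by (simp add: \<kappa>_left_commute[of y] mult.assoc)
  ultimately show ?thesis unfolding x using y
    by (simp add: distrib_left distrib_right \<kappa>_commute[of _ y])
qed

section \<open>Homomorphisms to matrices over the algebraic closure\<close>

text \<open>A splitting without its spanning condition, which holds automatically
  (\<open>scalar_hom_spans\<close>).\<close>

definition scalar_hom :: "('b \<Rightarrow> 'K alg_closure ^ 3 ^ 3) \<Rightarrow> bool" where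
  "scalar_hom \<rho> \<longleftrightarrow>
     (\<forall>c. \<rho> (\<kappa> c) = mat (to_ac c)) \<and>
     (\<forall>x y. \<rho> (x + y) = \<rho> x + \<rho> y) \<and>
     (\<forall>x y. \<rho> (x * y) = \<rho> x ** \<rho> y)"

lemma splitting_iff:
  "splitting \<kappa> \<rho> \<longleftrightarrow> scalar_hom \<rho> \<and> module.span (\<lambda>c M. mat c ** M) (range \<rho>) = UNIV"
  by (auto simp: splitting_def scalar_hom_def)

lemma
  assumes "scalar_hom \<rho>"
  shows hom_\<kappa>: "\<rho> (\<kappa> c) = mat (to_ac c)"
    and hom_add: "\<rho> (x + y) = \<rho> x + \<rho> y"
    and hom_mult: "\<rho> (x * y) = \<rho> x ** \<rho> y"
    and hom_0: "\<rho> 0 = 0" and hom_1: "\<rho> 1 = mat 1"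
    and hom_diff: "\<rho> (x - y) = \<rho> x - \<rho> y"
    and hom_sum: "\<rho> (sum f A) = (\<Sum>i\<in>A. \<rho> (f i))"
proof -
  show k: "\<rho> (\<kappa> c) = mat (to_ac c)" for c using assms by (simp add: scalar_hom_def)
  show add: "\<rho> (x + y) = \<rho> x + \<rho> y" for x y using assms by (simp add: scalar_hom_def)
  show "\<rho> (x * y) = \<rho> x ** \<rho> y" using assms by (simp add: scalar_hom_def)
  show zero: "\<rho> 0 = 0" using add[of 0 0] by simp
  show "\<rho> 1 = mat 1" using k[of 1] by simp
  show "\<rho> (x - y) = \<rho> x - \<rho> y" using add[of "x - y" y] by simp
  show "\<rho> (sum f A) = (\<Sum>i\<in>A. \<rho> (f i))"
    by (induction A rule: infinite_finite_induct) (simp_all add: zero add)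
qed

text \<open>In a nontrivial relation one coefficient in \<open>B\<close> can be normalised to 1.  Taking the commutator
  with an element of \<open>B\<close> then gives a shorter relation; so by induction all coefficients are
  central, and the relation is one over \<open>K\<close> between independent elements of the closure.\<close>

lemma hom_combination_eq_0:
  assumes \<rho>: "scalar_hom \<rho>" and "finite S"
    and "\<And>d. (\<Sum>c\<in>S. to_ac (d c) * c) = 0 \<Longrightarrow> \<forall>c\<in>S. d c = (0 :: 'K)"
    and "(\<Sum>c\<in>S. mat c ** \<rho> (b c)) = 0"
  shows "\<forall>c\<in>S. b c = 0"
  using assms(2-4)
proof (induction S arbitrary: b rule: finite_induct)
  case empty
  then show ?case by simp
next
  case (insert c0 S)
  note hom = hom_\<kappa>[OF \<rho>] hom_add[OF \<rho>] hom_mult[OF \<rho>] hom_0[OF \<rho>] hom_diff[OF \<rho>]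
  have indep: "\<forall>c\<in>S. d c = (0 :: 'K)" if d: "(\<Sum>c\<in>S. to_ac (d c) * c) = 0" for d
  proof -
    have "(\<Sum>c\<in>insert c0 S. to_ac ((d(c0 := 0)) c) * c) = (\<Sum>c\<in>S. to_ac ((d(c0 := 0)) c) * c)"
      using insert.hyps by simp
    also have "\<dots> = (\<Sum>c\<in>S. to_ac (d c) * c)"
      using insert.hyps by (intro sum.cong) auto
    finally have "\<forall>c\<in>insert c0 S. (d(c0 := 0)) c = 0" using insert.prems(1) d by metis
    then show ?thesis using insert.hyps by (metis fun_upd_apply insertCI)
  qed
  have "b c0 = 0"
  proof (rule ccontr)
    assume nz: "b c0 \<noteq> 0"
    define b' where "b' c = inverse (b c0) * b c" for c
    have b'0: "b' c0 = 1" using nz by (simp add: b'_def)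
    have rel: "(\<Sum>c\<in>insert c0 S. mat c ** \<rho> (b' c)) = 0"
    proof -
      have "(\<Sum>c\<in>insert c0 S. mat c ** \<rho> (b' c))
          = \<rho> (inverse (b c0)) ** (\<Sum>c\<in>insert c0 S. mat c ** \<rho> (b c))"
        unfolding matrix_mult_sum_right by (simp add: b'_def hom mat_left_commute)
      then show ?thesis using insert.prems(2) by simp
    qed
    have comm: "x * b' c = b' c * x" if "c \<in> insert c0 S" for x c
    proof -
      have "(\<Sum>c\<in>insert c0 S. mat c ** \<rho> (x * b' c - b' c * x))
          = \<rho> x ** (\<Sum>c\<in>insert c0 S. mat c ** \<rho> (b' c))
            - (\<Sum>c\<in>insert c0 S. mat c ** \<rho> (b' c)) ** \<rho> x"
        unfolding matrix_mult_sum_right matrix_mult_sum_left sum_subtractf[symmetric]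
        by (simp add: hom mat_left_commute matrix_3_diff_distrib matrix_mul_assoc[symmetric])
      then have "(\<Sum>c\<in>S. mat c ** \<rho> (x * b' c - b' c * x)) = 0"
        using insert.hyps rel b'0 by (simp add: hom_0[OF \<rho>])
      then have "\<forall>c\<in>S. x * b' c - b' c * x = 0" by (intro insert.IH indep)
      then show ?thesis using that b'0 by auto
    qed
    have "\<forall>c\<in>insert c0 S. \<exists>d. b' c = \<kappa> d"
    proof
      fix c assume "c \<in> insert c0 S"
      then have "b' c \<in> range \<kappa>" unfolding in_range_\<kappa>_iff using comm by metis
      then show "\<exists>d. b' c = \<kappa> d" by auto
    qed
    then obtain d where d: "\<And>c. c \<in> insert c0 S \<Longrightarrow> b' c = \<kappa> (d c)" by metis
    have "(mat (\<Sum>c\<in>insert c0 S. to_ac (d c) * c) :: 'K alg_closure ^ 3 ^ 3) = (\<Sum>c\<in>insert c0 S. mat c ** \<rho> (b' c))"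
      unfolding mat_sum by (intro sum.cong refl) (simp add: d hom mult.commute)
    then have "(\<Sum>c\<in>insert c0 S. to_ac (d c) * c) = 0" unfolding rel mat_eq_0_iff .
    then have "d c0 = 0" using insert.prems(1) by blast
    then show False using d[of c0] b'0 by simp
  qed
  moreover from this have "\<forall>c\<in>S. b c = 0"
    using insert.hyps insert.prems(2) by (intro insert.IH indep) (simp_all add: hom)
  ultimately show ?case by simp
qed

lemma vector_space_alg_closure: "vector_space (\<lambda>c x. to_ac (c :: 'K) * x)"
  by unfold_locales (simp_all add: algebra_simps)

text \<open>The image of a \<open>K\<close>-independent family under a \<open>K\<close>-algebra homomorphism to a matrix
  algebra over the closure stays independent over the closure: the scalar extension of a
  central division algebra is simple, so the extended homomorphism is injective.  Expanding the
  coefficients \<open>e\<close> in a basis of their span over \<open>K\<close> reduces this to the preceding lemma.\<close>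

lemma hom_independent:
  assumes \<rho>: "scalar_hom \<rho>" and J: "finite J"
    and indep: "\<And>d. (\<Sum>j\<in>J. \<kappa> (d j) * b j) = 0 \<Longrightarrow> \<forall>j\<in>J. d j = 0"
    and rel: "(\<Sum>j\<in>J. mat (e j) ** \<rho> (b j)) = 0"
  shows "\<forall>j\<in>J. e j = 0"
proof -
  interpret E: vector_space "\<lambda>c x. to_ac (c :: 'K) * x" by (rule vector_space_alg_closure)
  obtain S where S: "S \<subseteq> e ` J" "E.independent S" "e ` J \<subseteq> E.span S"
    by (rule E.maximal_independent_subset)
  have fS: "finite S" using S(1) J by (rule finite_subset[OF _ finite_imageI])
  have "\<forall>j\<in>J. \<exists>u. e j = (\<Sum>c\<in>S. to_ac (u c) * c)"
    using S(3) unfolding E.span_finite[OF fS] by blast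
  then obtain u where u: "\<And>j. j \<in> J \<Longrightarrow> e j = (\<Sum>c\<in>S. to_ac (u j c) * c)" by metis
  have "(\<Sum>c\<in>S. mat c ** \<rho> (\<Sum>j\<in>J. \<kappa> (u j c) * b j)) = (\<Sum>c\<in>S. \<Sum>j\<in>J. mat (to_ac (u j c) * c) ** \<rho> (b j))"
    by (intro sum.cong refl)
       (simp add: hom_sum[OF \<rho>] hom_mult[OF \<rho>] hom_\<kappa>[OF \<rho>] matrix_mult_sum_right matrix_mul_assoc mult.commute)
  also have "\<dots> = (\<Sum>j\<in>J. mat (e j) ** \<rho> (b j))"
    by (subst sum.swap, intro sum.cong refl) (simp add: u mat_sum matrix_mult_sum_left)
  finally have "\<forall>c\<in>S. (\<Sum>j\<in>J. \<kappa> (u j c) * b j) = 0"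
    using rel by (intro hom_combination_eq_0[OF \<rho> fS]) (use S(2) E.dependent_finite[OF fS] in auto)
  then have "\<forall>j\<in>J. u j c = 0" if "c \<in> S" for c
    using that by (intro indep) simp
  then show ?thesis using u by simp
qed

lemma cubic_relation:
  assumes "y \<notin> range \<kappa>"
  obtains t s n where "y ^ 3 = \<kappa> t * y\<^sup>2 - \<kappa> s * y + \<kappa> n"
proof -
  have "y ^ 3 * y = y * y ^ 3" by (simp add: power3_eq_cube mult.assoc)
  from commuting_imp_polynomial[OF assms this] obtain n s t
    where "y ^ 3 = \<kappa> n + \<kappa> s * y + \<kappa> t * y\<^sup>2" .
  then have "y ^ 3 = \<kappa> t * y\<^sup>2 - \<kappa> (- s) * y + \<kappa> n" by (simp add: algebra_simps)
  then show thesis by (rule that)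
qed

text \<open>Independence of \<open>1, y, y\<^sup>2\<close> survives in the matrix algebra, so the cubic relation of \<open>y\<close> over
  \<open>K\<close> must be the one from Cayley and Hamilton.\<close>

lemma char_coeffs_noncentral:
  assumes \<rho>: "scalar_hom \<rho>" and y: "y \<notin> range \<kappa>"
    and rel: "y ^ 3 = \<kappa> t * y\<^sup>2 - \<kappa> s * y + \<kappa> n"
  shows "trace (\<rho> y) = to_ac t" "minors_sum (\<rho> y) = to_ac s" "det (\<rho> y) = to_ac n"
proof -
  note hom = hom_\<kappa>[OF \<rho>] hom_add[OF \<rho>] hom_mult[OF \<rho>] hom_0[OF \<rho>] hom_1[OF \<rho>] hom_diff[OF \<rho>]
  define e where "e = (\<lambda>i::nat. if i = 0 then det (\<rho> y) - to_ac n else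
      if i = 1 then to_ac s - minors_sum (\<rho> y) else trace (\<rho> y) - to_ac t)"
  have "mat (to_ac t) ** (\<rho> y ** \<rho> y) - mat (to_ac s) ** \<rho> y + mat (to_ac n) = \<rho> (y ^ 3)"
    unfolding rel by (simp add: hom power2_eq_square)
  also have "\<dots> = \<rho> y ** \<rho> y ** \<rho> y" by (simp add: hom power3_eq_cube matrix_mul_assoc)
  also have "\<dots> = mat (trace (\<rho> y)) ** (\<rho> y ** \<rho> y) - mat (minors_sum (\<rho> y)) ** \<rho> y
      + mat (det (\<rho> y))" by (rule cayley_hamilton_3)
  finally have eq: "mat (to_ac t) ** (\<rho> y ** \<rho> y) - mat (to_ac s) ** \<rho> y + mat (to_ac n)
    = mat (trace (\<rho> y)) ** (\<rho> y ** \<rho> y) - mat (minors_sum (\<rho> y)) ** \<rho> y + mat (det (\<rho> y))" .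
  have sum3: "(\<Sum>j\<in>{0,1,2::nat}. f j) = f 0 + f 1 + f 2" for f :: "nat \<Rightarrow> 'c::comm_monoid_add"
    by (simp add: add.assoc)
  have "(\<Sum>j\<in>{0,1,2::nat}. mat (e j) ** \<rho> (y ^ j)) = 0"
    unfolding sum3 using eq
    by (simp add: e_def hom power2_eq_square mat_diff matrix_3_diff_distrib algebra_simps)
  then have "\<forall>j\<in>{0,1,2::nat}. e j = 0"
  proof (rule hom_independent[OF \<rho> _ _, rotated 2])
    fix d :: "nat \<Rightarrow> 'K" assume "(\<Sum>j\<in>{0,1,2::nat}. \<kappa> (d j) * y ^ j) = 0"
    then have "\<kappa> (d 0) + \<kappa> (d 1) * y + \<kappa> (d 2) * y\<^sup>2 = 0" unfolding sum3 by simp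
    from quadratic_relation_trivial[OF y this] show "\<forall>j\<in>{0,1,2::nat}. d j = 0" by simp
  qed simp
  then show "trace (\<rho> y) = to_ac t" "minors_sum (\<rho> y) = to_ac s" "det (\<rho> y) = to_ac n"
    by (simp_all add: e_def)
qed

lemma map_poly_to_ac_inject: "map_poly to_ac p = map_poly to_ac q \<longleftrightarrow> p = q"
  by (auto simp: poly_eq_iff coeff_map_poly)

lemma matrix_char_poly_descends:
  "\<exists>q. \<forall>\<rho>. scalar_hom \<rho> \<longrightarrow> map_poly to_ac q = matrix_char_poly (\<rho> y)"
proof (cases "y \<in> range \<kappa>")
  case True
  then obtain c where y: "y = \<kappa> c" by auto
  have "map_poly to_ac [:- (c ^ 3), c\<^sup>2 + c\<^sup>2 + c\<^sup>2, - (c + c + c), 1:] = matrix_char_poly (\<rho> y)"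
    if "scalar_hom \<rho>" for \<rho>
    unfolding y hom_\<kappa>[OF that] matrix_char_poly_3
    by (simp add: map_poly_pCons matrix_3_simps power2_eq_square power3_eq_cube)
  then show ?thesis by blast
next
  case False
  then obtain t s n where rel: "y ^ 3 = \<kappa> t * y\<^sup>2 - \<kappa> s * y + \<kappa> n" by (rule cubic_relation)
  have "map_poly to_ac [:- n, s, - t, 1:] = matrix_char_poly (\<rho> y)" if "scalar_hom \<rho>" for \<rho>
    unfolding matrix_char_poly_3 char_coeffs_noncentral[OF that False rel] by (simp add: map_poly_pCons)
  then show ?thesis by blast
qed

section \<open>Existence of a splitting\<close>

lemma noncentral_exists: "\<exists>z. z \<notin> range \<kappa>"
proof (rule ccontr)
  assume "\<nexists>z. z \<notin> range \<kappa>"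
  then have "UNIV \<subseteq> B.span {1}" using mem_span_1 by (metis image_iff subsetI)
  then have "B.dim UNIV \<le> card {1 :: 'b}" by (rule B.dim_le_card) simp
  then show False using dim_B by simp
qed

lemma centralizer_mult:
  "x * z = z * x \<Longrightarrow> y * z = z * y \<Longrightarrow> (x * y) * z = z * (x * y :: 'b)"
  by (metis mult.assoc)

text \<open>The basis is \<open>1, b, b'\<close>, with each element outside the left submodule generated by the previous
  ones; these submodules have dimensions 3, 6 and 9 over \<open>K\<close>.\<close>

lemma left_basis_over_centralizer:
  assumes z: "z \<notin> range \<kappa>"
  obtains e :: "3 \<Rightarrow> 'b" where
    "\<forall>x. \<exists>l. (\<forall>k. l k * z = z * l k) \<and> x = (\<Sum>k\<in>UNIV. l k * e k)"
    "\<forall>l. (\<forall>k. l k * z = z * l k) \<longrightarrow> (\<Sum>k\<in>UNIV. l k * e k) = 0 \<longrightarrow> (\<forall>k. l k = 0)"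
proof -
  define C where "C = {x. x * z = z * x}"
  have C: "B.subspace C" unfolding C_def by (rule subspace_centralizer)
  have Cm: "\<And>m m'. m \<in> C \<Longrightarrow> m' \<in> C \<Longrightarrow> m * m' \<in> C" unfolding C_def using centralizer_mult by auto
  have dC: "B.dim C = 3" unfolding C_def by (rule dim_centralizer[OF z])
  have proper: "\<exists>b. b \<notin> W" if "B.dim W < 9" for W
    using that dim_B by (metis UNIV_eq_I order_less_irrefl)
  obtain b where b: "b \<notin> C" using proper[of C] dC by auto
  define W where "W = add_translate C C b"
  note W = add_translate[OF C Cm C Cm b, folded W_def]
  have Wm: "\<And>m w. m \<in> C \<Longrightarrow> w \<in> W \<Longrightarrow> m * w \<in> W" using W(2) Cm by metis
  obtain b' where b': "b' \<notin> W" using proper[of W] W(3) dC by auto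
  note W' = add_translate[OF C Cm W(1) Wm b']
  have "add_translate C W b' = UNIV"
    using B.subspace_dim_equal[OF W'(1) B.subspace_UNIV] W'(3) W(3) dC dim_B by simp
  then have "x \<in> add_translate C W b'" for x by simp
  then have gen: "\<exists>l1 l2 l3. l1 \<in> C \<and> l2 \<in> C \<and> l3 \<in> C \<and> x = l1 + l2 * b + l3 * b'" for x
    unfolding add_translate_def W_def by fastforce
  have nz: "b \<noteq> 0" "b' \<noteq> 0" using b b' B.subspace_0[OF C] B.subspace_0[OF W(1)] by auto
  have int: "C \<inter> (\<lambda>m. m * b) ` C = {0}"
    by (rule add_translate(4)[OF C _ C _ b]) (auto intro: Cm)
  have int': "W \<inter> (\<lambda>m. m * b') ` C = {0}"
    by (rule add_translate(4)[OF C _ W(1) _ b']) (auto intro: Cm Wm)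
  have ind: "l1 = 0 \<and> l2 = 0 \<and> l3 = 0"
    if l: "l1 \<in> C" "l2 \<in> C" "l3 \<in> C" "l1 + l2 * b + l3 * b' = 0" for l1 l2 l3
  proof -
    have "l1 + l2 * b \<in> W" unfolding W_def add_translate_def using l(1,2) by auto
    moreover have "l3 * b' = - (l1 + l2 * b)" using l(4) by (metis add_eq_0_iff)
    ultimately have "l3 * b' \<in> W" using B.subspace_neg[OF W(1)] by metis
    then have "l3 * b' \<in> W \<inter> (\<lambda>m. m * b') ` C" using l(3) by (rule IntI[OF _ imageI])
    then have "l3 * b' \<in> {0}" unfolding int' .
    then have 3: "l3 = 0" using nz by simp
    then have "l2 * b = - l1" using l(4) by (metis add_eq_0_iff add.right_neutral mult_zero_left)
    then have "l2 * b \<in> C" using B.subspace_neg[OF C] l(1) by metis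
    then have "l2 * b \<in> C \<inter> (\<lambda>m. m * b) ` C" using l(2) by (rule IntI[OF _ imageI])
    then have "l2 * b \<in> {0}" unfolding int .
    then have "l2 = 0" using nz by simp
    then show ?thesis using 3 l(4) by simp
  qed
  define e :: "3 \<Rightarrow> 'b" where "e k = (if k = 1 then 1 else if k = 2 then b else b')" for k
  have e: "(\<Sum>k\<in>UNIV. l k * e k) = l 1 + l 2 * b + l 3 * b'" for l
    by (simp add: e_def sum_3)
  show thesis
  proof (rule that; intro allI impI)
    fix x
    obtain l1 l2 l3 where "l1 \<in> C" "l2 \<in> C" "l3 \<in> C" "x = l1 + l2 * b + l3 * b'" using gen by blast
    then show "\<exists>l. (\<forall>k. l k * z = z * l k) \<and> x = (\<Sum>k\<in>UNIV. l k * e k)"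
      by (intro exI[of _ "\<lambda>k. if k = 1 then l1 else if k = 2 then l2 else l3"]) (simp add: e C_def)
  next
    fix l k assume l: "\<forall>k. l k * z = z * l k" "(\<Sum>k\<in>UNIV. l k * e k) = 0"
    then have "l 1 = 0 \<and> l 2 = 0 \<and> l 3 = 0" by (intro ind) (auto simp: C_def e)
    then show "l k = 0" using exhaust_3[of k] by auto
  qed
qed

text \<open>The centralizer is generated by \<open>z\<close>, and \<open>\<tau>\<close> sends \<open>z\<close> to a root \<open>\<zeta>\<close> of its cubic equation.  Products
  of quadratic polynomials have degree at most 4, and \<open>z\<close> and \<open>\<zeta>\<close> reduce third and fourth powers
  in the same way.\<close>

lemma embed_centralizer_in_closure:
  assumes z: "z \<notin> range \<kappa>"
  obtains \<tau> :: "'b \<Rightarrow> 'K alg_closure" where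
    "\<forall>c. \<tau> (\<kappa> c) = to_ac c"
    "\<forall>x y. x * z = z * x \<longrightarrow> y * z = z * y \<longrightarrow> \<tau> (x + y) = \<tau> x + \<tau> y"
    "\<forall>x y. x * z = z * x \<longrightarrow> y * z = z * y \<longrightarrow> \<tau> (x * y) = \<tau> x * \<tau> y"
proof -
  obtain r2 r1 r0 where "z ^ 3 = \<kappa> r2 * z\<^sup>2 - \<kappa> r1 * z + \<kappa> r0" using cubic_relation[OF z] .
  then have z3: "z ^ 3 = \<kappa> r0 + \<kappa> (- r1) * z + \<kappa> r2 * z\<^sup>2" by (simp add: algebra_simps)
  have "z ^ 4 = z ^ 3 * z" by (simp add: numeral_eq_Suc mult.assoc)
  also have "\<dots> = \<kappa> r0 * z + \<kappa> (- r1) * z\<^sup>2 + \<kappa> r2 * z ^ 3"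
    unfolding z3[THEN arg_cong, of "\<lambda>w. w * z"]
    by (simp add: distrib_right left_diff_distrib mult.assoc power2_eq_square power3_eq_cube)
  also have "\<kappa> r2 * z ^ 3 = \<kappa> (r2 * r0) + \<kappa> (- (r2 * r1)) * z + \<kappa> (r2 * r2) * z\<^sup>2"
    unfolding z3 by (simp add: distrib_left right_diff_distrib mult.assoc)
  also have "\<kappa> r0 * z + \<kappa> (- r1) * z\<^sup>2 + \<dots> = \<kappa> (r2 * r0) + \<kappa> (r0 - r2 * r1) * z + \<kappa> (r2 * r2 - r1) * z\<^sup>2"
    by (simp add: algebra_simps del: \<kappa>_mult)
  finally have z4: "z ^ 4 = \<kappa> (r2 * r0) + \<kappa> (r0 - r2 * r1) * z + \<kappa> (r2 * r2 - r1) * z\<^sup>2" .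
  have "\<exists>x. poly [:- to_ac r0, to_ac r1, - to_ac r2, 1:] x = 0"
    by (rule alg_closed_imp_poly_has_root) simp
  then obtain \<zeta> :: "'K alg_closure" where "poly [:- to_ac r0, to_ac r1, - to_ac r2, 1:] \<zeta> = 0" by blast
  then have \<zeta>3: "\<zeta> ^ 3 = to_ac r0 - to_ac r1 * \<zeta> + to_ac r2 * \<zeta>\<^sup>2"
    by (simp add: power2_eq_square power3_eq_cube algebra_simps eq_neg_iff_add_eq_0)
  have "\<zeta> ^ 4 = \<zeta> ^ 3 * \<zeta>" by (simp add: numeral_eq_Suc)
  also have "\<dots> = to_ac r0 * \<zeta> - to_ac r1 * \<zeta>\<^sup>2 + to_ac r2 * \<zeta> ^ 3"
    unfolding \<zeta>3[THEN arg_cong, of "\<lambda>w. w * \<zeta>"]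
    by (simp add: algebra_simps power2_eq_square power3_eq_cube)
  also have "\<dots> = to_ac (r2 * r0) + to_ac (r0 - r2 * r1) * \<zeta> + to_ac (r2 * r2 - r1) * \<zeta>\<^sup>2"
    unfolding \<zeta>3 by (simp add: algebra_simps)
  finally have \<zeta>4: "\<zeta> ^ 4 = to_ac (r2 * r0) + to_ac (r0 - r2 * r1) * \<zeta> + to_ac (r2 * r2 - r1) * \<zeta>\<^sup>2" .
  define \<tau> where "\<tau> x = (THE v. \<exists>a b c. x = \<kappa> a + \<kappa> b * z + \<kappa> c * z\<^sup>2 \<and>
      v = to_ac a + to_ac b * \<zeta> + to_ac c * \<zeta>\<^sup>2)" for x
  have \<tau>: "\<tau> (\<kappa> a + \<kappa> b * z + \<kappa> c * z\<^sup>2) = to_ac a + to_ac b * \<zeta> + to_ac c * \<zeta>\<^sup>2" for a b c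
    unfolding \<tau>_def
  proof (rule the_equality)
    fix v assume "\<exists>a' b' c'. \<kappa> a + \<kappa> b * z + \<kappa> c * z\<^sup>2 = \<kappa> a' + \<kappa> b' * z + \<kappa> c' * z\<^sup>2 \<and>
      v = to_ac a' + to_ac b' * \<zeta> + to_ac c' * \<zeta>\<^sup>2"
    then obtain a' b' c' where eq: "\<kappa> a + \<kappa> b * z + \<kappa> c * z\<^sup>2 = \<kappa> a' + \<kappa> b' * z + \<kappa> c' * z\<^sup>2"
      and v: "v = to_ac a' + to_ac b' * \<zeta> + to_ac c' * \<zeta>\<^sup>2" by blast
    have "\<kappa> (a - a') + \<kappa> (b - b') * z + \<kappa> (c - c') * z\<^sup>2 = 0" using eq by (simp add: algebra_simps)
    from quadratic_relation_trivial[OF z this] show "v = to_ac a + to_ac b * \<zeta> + to_ac c * \<zeta>\<^sup>2"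
      using v by simp
  qed blast
  show thesis
  proof (rule that; intro allI impI)
    show "\<tau> (\<kappa> c) = to_ac c" for c using \<tau>[of c 0 0] by simp
  next
    fix x y assume "x * z = z * x" "y * z = z * y"
    then obtain a b c a' b' c' where x: "x = \<kappa> a + \<kappa> b * z + \<kappa> c * z\<^sup>2"
      and y: "y = \<kappa> a' + \<kappa> b' * z + \<kappa> c' * z\<^sup>2"
      using commuting_imp_polynomial[OF z] by metis
    have "x + y = \<kappa> (a + a') + \<kappa> (b + b') * z + \<kappa> (c + c') * z\<^sup>2"
      unfolding x y by (simp add: algebra_simps)
    then have "\<tau> (x + y) = to_ac (a + a') + to_ac (b + b') * \<zeta> + to_ac (c + c') * \<zeta>\<^sup>2"
      by (simp only: \<tau>)
    then show "\<tau> (x + y) = \<tau> x + \<tau> y" unfolding x y \<tau> by (simp add: algebra_simps)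
  next
    fix x y assume "x * z = z * x" "y * z = z * y"
    then obtain a b c a' b' c' where x: "x = \<kappa> a + \<kappa> b * z + \<kappa> c * z\<^sup>2"
      and y: "y = \<kappa> a' + \<kappa> b' * z + \<kappa> c' * z\<^sup>2"
      using commuting_imp_polynomial[OF z] by metis
    have mono: "(\<kappa> d * z ^ i) * (\<kappa> d' * z ^ j) = \<kappa> (d * d') * z ^ (i + j)" for d d' i j
      using \<kappa>_left_commute[of "z ^ i" d' "z ^ j"] by (simp add: mult.assoc power_add)
    have "x * y = (\<kappa> a * z ^ 0 + \<kappa> b * z ^ 1 + \<kappa> c * z ^ 2) * (\<kappa> a' * z ^ 0 + \<kappa> b' * z ^ 1 + \<kappa> c' * z ^ 2)"
      unfolding x y by simp
    also have "\<dots> = \<kappa> (a * a') * z ^ 0 + \<kappa> (a * b' + b * a') * z ^ 1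
        + \<kappa> (a * c' + b * b' + c * a') * z ^ 2 + \<kappa> (b * c' + c * b') * z ^ 3 + \<kappa> (c * c') * z ^ 4"
      by (simp only: distrib_left distrib_right mono \<kappa>_add) (simp add: add_ac numeral_eq_Suc del: \<kappa>_mult)
    also have "\<dots> = \<kappa> (a * a' + (b * c' + c * b') * r0 + c * c' * (r2 * r0))
      + \<kappa> (a * b' + b * a' - (b * c' + c * b') * r1 + c * c' * (r0 - r2 * r1)) * z
      + \<kappa> (a * c' + b * b' + c * a' + (b * c' + c * b') * r2 + c * c' * (r2 * r2 - r1)) * z\<^sup>2"
      unfolding z3 z4 by (simp add: algebra_simps)
    finally have xy: "x * y = \<dots>" .
    have "\<tau> (x * y) = to_ac (a * a' + (b * c' + c * b') * r0 + c * c' * (r2 * r0))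
      + to_ac (a * b' + b * a' - (b * c' + c * b') * r1 + c * c' * (r0 - r2 * r1)) * \<zeta>
      + to_ac (a * c' + b * b' + c * a' + (b * c' + c * b') * r2 + c * c' * (r2 * r2 - r1)) * \<zeta>\<^sup>2"
      unfolding xy by (rule \<tau>)
    also have "\<dots> = to_ac (a * a') + to_ac (a * b' + b * a') * \<zeta> + to_ac (a * c' + b * b' + c * a') * \<zeta>\<^sup>2
        + to_ac (b * c' + c * b') * \<zeta> ^ 3 + to_ac (c * c') * \<zeta> ^ 4"
      unfolding \<zeta>3 \<zeta>4 by (simp add: algebra_simps)
    also have "\<dots> = (to_ac a + to_ac b * \<zeta> + to_ac c * \<zeta>\<^sup>2) * (to_ac a' + to_ac b' * \<zeta> + to_ac c' * \<zeta>\<^sup>2)"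
      by (simp add: algebra_simps numeral_eq_Suc)
    also have "\<dots> = \<tau> x * \<tau> y" unfolding x y \<tau> ..
    finally show "\<tau> (x * y) = \<tau> x * \<tau> y" .
  qed
qed

text \<open>As a left vector space over the maximal subfield generated by a noncentral element, \<open>B\<close> has
  dimension 3, and right multiplications act on it by matrices over that subfield.\<close>

lemma scalar_hom_exists: "\<exists>\<rho>. scalar_hom \<rho>"
proof -
  obtain z where z: "z \<notin> range \<kappa>" using noncentral_exists by blast
  obtain e :: "3 \<Rightarrow> 'b" where
    gen: "\<forall>x. \<exists>l. (\<forall>k. l k * z = z * l k) \<and> x = (\<Sum>k\<in>UNIV. l k * e k)" and
    ind: "\<forall>l. (\<forall>k. l k * z = z * l k) \<longrightarrow> (\<Sum>k\<in>UNIV. l k * e k) = 0 \<longrightarrow> (\<forall>k. l k = 0)"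
    by (rule left_basis_over_centralizer[OF z])
  obtain \<tau> :: "'b \<Rightarrow> 'K alg_closure" where \<tau>: "\<forall>c. \<tau> (\<kappa> c) = to_ac c"
    "\<forall>x y. x * z = z * x \<longrightarrow> y * z = z * y \<longrightarrow> \<tau> (x + y) = \<tau> x + \<tau> y"
    "\<forall>x y. x * z = z * x \<longrightarrow> y * z = z * y \<longrightarrow> \<tau> (x * y) = \<tau> x * \<tau> y"
    by (rule embed_centralizer_in_closure[OF z])
  note \<tau>_\<kappa> = \<tau>(1)[rule_format] and \<tau>_add = \<tau>(2)[rule_format] and \<tau>_mult = \<tau>(3)[rule_format]
  obtain co where co_all: "\<forall>x. (\<forall>k. co x k * z = z * co x k) \<and> x = (\<Sum>k\<in>UNIV. co x k * e k)"
    using choice[OF gen] ..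
  have co_comm: "co x k * z = z * co x k" for x k using co_all by blast
  have co: "x = (\<Sum>k\<in>UNIV. co x k * e k)" for x using co_all by blast
  have unique: "co x k = l k" if "\<forall>k. l k * z = z * l k" "x = (\<Sum>k\<in>UNIV. l k * e k)" for x l k
  proof -
    have "(\<Sum>k\<in>UNIV. (co x k - l k) * e k) = (\<Sum>k\<in>UNIV. co x k * e k) - (\<Sum>k\<in>UNIV. l k * e k)"
      by (simp add: left_diff_distrib sum_subtractf)
    also have "\<dots> = 0" unfolding co[symmetric] that(2)[symmetric] by simp
    finally have "(\<Sum>k\<in>UNIV. (co x k - l k) * e k) = 0" .
    then have sum0: "(\<Sum>k\<in>UNIV. (co x k - l k) * e k) = 0" .
    have "(co x k - l k) * z = z * (co x k - l k)" for k
      unfolding left_diff_distrib right_diff_distrib co_comm that(1)[rule_format] ..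
    then have "\<forall>k. co x k - l k = 0" by (intro ind[THEN spec, THEN mp, THEN mp, OF _ sum0] allI)
    then show ?thesis by simp
  qed
  have sum_comm: "sum f A * z = z * sum f A" if "\<And>i. f i * z = z * f i" for f :: "3 \<Rightarrow> 'b" and A
    using that by (simp add: sum_distrib_left sum_distrib_right)
  have \<tau>_sum: "\<tau> (\<Sum>j\<in>A. f j * g j) = (\<Sum>j\<in>A. \<tau> (f j) * \<tau> (g j))"
    if "finite A" "\<And>j. f j * z = z * f j" "\<And>j. g j * z = z * g j" for f g :: "3 \<Rightarrow> 'b" and A
    using that(1)
  proof (induction A rule: finite_induct)
    case empty
    show ?case using \<tau>_\<kappa>[of 0] by simp
  next
    case (insert a A)
    have "\<tau> (f a * g a + (\<Sum>j\<in>A. f j * g j)) = \<tau> (f a * g a) + \<tau> (\<Sum>j\<in>A. f j * g j)"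
      by (intro \<tau>_add sum_comm centralizer_mult that)
    then show ?case using insert \<tau>_mult that by simp
  qed
  define \<rho> where "\<rho> x = (\<chi> i k. \<tau> (co (e i * x) k))" for x
  have "\<rho> (\<kappa> c) = mat (to_ac c)" for c
  proof -
    have "co (e i * \<kappa> c) k = (if k = i then \<kappa> c else 0)" for i k
    proof (rule unique)
      have "(\<Sum>k\<in>UNIV. (if k = i then \<kappa> c else 0) * e k) = (\<Sum>k\<in>UNIV. if k = i then \<kappa> c * e k else 0)"
        by (rule sum.cong) auto
      also have "\<dots> = e i * \<kappa> c" using \<kappa>_commute[of c "e i"] by simp
      finally show "e i * \<kappa> c = (\<Sum>k\<in>UNIV. (if k = i then \<kappa> c else 0) * e k)" ..
      show "\<forall>k. (if k = i then \<kappa> c else 0) * z = z * (if k = i then \<kappa> c else 0)"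
        using \<kappa>_commute[of c z] by simp
    qed
    then show ?thesis using \<tau>_\<kappa> \<tau>_\<kappa>[of 0] by (simp add: \<rho>_def vec_eq_iff mat_def)
  qed
  moreover have "\<rho> (x + y) = \<rho> x + \<rho> y" for x y
  proof -
    have "co (e i * (x + y)) k = co (e i * x) k + co (e i * y) k" for i k
    proof (rule unique)
      have "e i * (x + y) = (\<Sum>k\<in>UNIV. co (e i * x) k * e k) + (\<Sum>k\<in>UNIV. co (e i * y) k * e k)"
        unfolding co[symmetric] by (rule distrib_left)
      then show "e i * (x + y) = (\<Sum>k\<in>UNIV. (co (e i * x) k + co (e i * y) k) * e k)"
        by (simp add: distrib_right sum.distrib)
    qed (simp add: co_comm distrib_left distrib_right)
    then show ?thesis using \<tau>_add co_comm by (simp add: \<rho>_def vec_eq_iff)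
  qed
  moreover have "\<rho> (x * y) = \<rho> x ** \<rho> y" for x y
  proof -
    have "co (e i * (x * y)) k = (\<Sum>j\<in>UNIV. co (e i * x) j * co (e j * y) k)" for i k
    proof (rule unique)
      have "e i * (x * y) = (\<Sum>j\<in>UNIV. co (e i * x) j * e j) * y"
        unfolding co[symmetric] by (rule mult.assoc[symmetric])
      also have "\<dots> = (\<Sum>j\<in>UNIV. co (e i * x) j * (e j * y))"
        by (simp add: sum_distrib_right mult.assoc)
      also have "\<dots> = (\<Sum>j\<in>UNIV. co (e i * x) j * (\<Sum>k\<in>UNIV. co (e j * y) k * e k))"
        unfolding co[symmetric] ..
      also have "\<dots> = (\<Sum>j\<in>UNIV. \<Sum>k\<in>UNIV. co (e i * x) j * co (e j * y) k * e k)"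
        by (simp add: sum_distrib_left mult.assoc)
      also have "\<dots> = (\<Sum>k\<in>UNIV. \<Sum>j\<in>UNIV. co (e i * x) j * co (e j * y) k * e k)"
        by (rule sum.swap)
      finally show "e i * (x * y) = (\<Sum>k\<in>UNIV. (\<Sum>j\<in>UNIV. co (e i * x) j * co (e j * y) k) * e k)"
        by (simp add: sum_distrib_right)
    qed (intro allI sum_comm centralizer_mult co_comm)
    then show ?thesis
      using \<tau>_sum co_comm by (simp add: \<rho>_def vec_eq_iff matrix_matrix_mult_def)
  qed
  ultimately have "scalar_hom \<rho>" unfolding scalar_hom_def by (intro conjI allI)
  then show ?thesis by (rule exI[of scalar_hom \<rho>])
qed

text \<open>Nine independent elements of \<open>B\<close> have nine independent images, and these fill the matrix
  algebra.\<close>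

lemma scalar_hom_spans:
  assumes \<rho>: "scalar_hom \<rho>"
  shows "module.span (\<lambda>c M. mat c ** M) (range \<rho>) = UNIV"
proof -
  interpret M: vector_space "\<lambda>c M. mat c ** (M :: 'K alg_closure ^ 3 ^ 3)"
    by (rule vector_space_matrices)
  have fB: "finite B_basis" using B_basis(3) by (intro card_ge_0_finite) simp
  have indep: "\<forall>b\<in>B_basis. e b = 0" if "(\<Sum>b\<in>B_basis. mat (e b) ** \<rho> b) = 0" for e
  proof (rule hom_independent[OF \<rho> fB _ that])
    fix d assume "(\<Sum>b\<in>B_basis. \<kappa> (d b) * b) = 0"
    then show "\<forall>b\<in>B_basis. d b = 0" using B_basis(1) unfolding B.dependent_finite[OF fB] by blast
  qed
  have inj: "inj_on \<rho> B_basis"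
  proof (rule inj_onI, rule ccontr)
    fix x y assume xy: "x \<in> B_basis" "y \<in> B_basis" "\<rho> x = \<rho> y" "x \<noteq> y"
    have "(\<Sum>b\<in>B_basis. mat (if b = x then 1 else if b = y then - 1 else 0) ** \<rho> b)
        = (\<Sum>b\<in>{x, y}. mat (if b = x then 1 else if b = y then - 1 else 0) ** \<rho> b)"
      using xy fB by (intro sum.mono_neutral_right) auto
    also have "\<dots> = 0" using xy by (simp add: vec_eq_iff)
    finally have "\<forall>b\<in>B_basis. (if b = x then 1 else if b = y then - 1 else 0) = (0 :: 'K alg_closure)"
      by (rule indep)
    from bspec[OF this xy(1)] show False by simp
  qed
  have ind: "M.independent (\<rho> ` B_basis)"
  proof
    assume "M.dependent (\<rho> ` B_basis)"
    then obtain w A where w: "A \<in> \<rho> ` B_basis" "w A \<noteq> 0" "(\<Sum>v\<in>\<rho> ` B_basis. mat (w v) ** v) = 0"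
      unfolding M.dependent_finite[OF finite_imageI[OF fB]] by blast
    then have "(\<Sum>b\<in>B_basis. mat (w (\<rho> b)) ** \<rho> b) = 0" by (simp add: sum.reindex[OF inj])
    from indep[OF this] show False using w(1,2) by auto
  qed
  have card: "card (\<rho> ` B_basis) = 9" using card_image[OF inj] B_basis(3) by simp
  obtain Bs where Bs: "Bs \<subseteq> UNIV" "M.independent Bs" "UNIV \<subseteq> M.span Bs"
    by (rule M.maximal_independent_subset)
  have 9: "finite Bs \<and> card Bs \<le> 9"
  proof -
    let ?E = "(\<lambda>(i, j). (\<chi> k l. if k = i \<and> l = j then 1 else 0) :: 'K alg_closure ^ 3 ^ 3) ` UNIV"
    have "card ?E \<le> card (UNIV :: (3 \<times> 3) set)" by (rule card_image_le) simp
    moreover have "finite Bs \<and> card Bs \<le> card ?E"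
    proof (rule M.independent_span_bound[OF _ Bs(2)])
      show "Bs \<subseteq> M.span ?E" using matrix_units_span by (rule order_trans[OF subset_UNIV])
    qed simp
    ultimately show ?thesis by simp
  qed
  interpret F: finite_dimensional_vector_space "\<lambda>c M. mat c ** (M :: 'K alg_closure ^ 3 ^ 3)" Bs
  proof
    show "finite Bs" using 9 by blast
    show "M.independent Bs" by fact
    show "M.span Bs = UNIV" using Bs(3) by (rule top.extremum_uniqueI)
  qed
  have "UNIV \<subseteq> M.span (\<rho> ` B_basis)"
    by (rule F.card_ge_dim_independent[OF subset_UNIV ind]) (simp add: card 9)
  also have "\<dots> \<subseteq> M.span (range \<rho>)" by (intro M.span_mono image_mono subset_UNIV)
  finally show ?thesis by (rule top.extremum_uniqueI)
qed

lemma splitting_iff_scalar_hom: "splitting \<kappa> \<rho> \<longleftrightarrow> scalar_hom \<rho>"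
  unfolding splitting_iff using scalar_hom_spans[of \<rho>] by fast

theorem red_char_poly_eq:
  assumes "scalar_hom \<rho>"
  shows "map_poly to_ac (red_char_poly \<kappa> y) = matrix_char_poly (\<rho> y)"
proof -
  obtain q where q_all: "\<forall>\<rho>. scalar_hom \<rho> \<longrightarrow> map_poly to_ac q = matrix_char_poly (\<rho> y)"
    using matrix_char_poly_descends[of y] ..
  note q = q_all[rule_format]
  have "red_char_poly \<kappa> y = q"
    unfolding red_char_poly_def splitting_iff_scalar_hom
  proof (rule the_equality)
    show "\<exists>\<rho>. scalar_hom \<rho> \<and> map_poly to_ac q = matrix_char_poly (\<rho> y)" using assms q[OF assms] by fast
    show "q' = q" if q': "\<exists>\<rho>. scalar_hom \<rho> \<and> map_poly to_ac q' = matrix_char_poly (\<rho> y)" for q'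
    proof -
      obtain \<rho>' where "scalar_hom \<rho>'" "map_poly to_ac q' = matrix_char_poly (\<rho>' y)"
        using q' by (elim exE conjE)
      then have "map_poly to_ac q' = map_poly to_ac q" using q[of \<rho>'] by simp
      then show ?thesis by (simp only: map_poly_to_ac_inject)
    qed
  qed
  then show ?thesis using q assms by simp
qed

section \<open>Reduced norm, trace and adjoint\<close>

text \<open>By \<open>red_char_poly_eq\<close> the reduced characteristic polynomial can be computed in any one
  representation.\<close>

definition rep :: "'b \<Rightarrow> 'K alg_closure ^ 3 ^ 3" where
  "rep = (SOME \<rho>. scalar_hom \<rho>)"

lemma scalar_hom_rep: "scalar_hom rep"
  unfolding rep_def using scalar_hom_exists by (rule someI_ex)

lemmas rep_simps = hom_\<kappa>[OF scalar_hom_rep] hom_add[OF scalar_hom_rep] hom_mult[OF scalar_hom_rep]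
  hom_0[OF scalar_hom_rep] hom_1[OF scalar_hom_rep] hom_diff[OF scalar_hom_rep]

lemma rep_eq_0_iff: "rep x = 0 \<longleftrightarrow> x = 0"
proof
  assume *: "rep x = 0"
  show "x = 0"
  proof (rule ccontr)
    assume "x \<noteq> 0"
    then have "rep x ** rep (inverse x) = mat 1" by (simp flip: rep_simps)
    moreover have "rep x ** rep (inverse x) = 0" unfolding * by (simp add: vec_eq_iff matrix_matrix_mult_def)
    ultimately have "(mat 1 :: 'K alg_closure ^ 3 ^ 3) = 0" by simp
    then show False by (simp add: mat_eq_0_iff)
  qed
qed (simp add: rep_simps)

lemma rep_inject: "rep x = rep y \<longleftrightarrow> x = y"
  using rep_eq_0_iff[of "x - y"] by (simp add: rep_simps)

lemma
  shows to_ac_trd: "to_ac (trd \<kappa> y) = trace (rep y)"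
    and to_ac_srd: "to_ac (srd \<kappa> y) = minors_sum (rep y)"
    and to_ac_nrd: "to_ac (nrd \<kappa> y) = det (rep y)"
proof -
  have "to_ac (poly.coeff (red_char_poly \<kappa> y) i) = poly.coeff [:- det (rep y), minors_sum (rep y), - trace (rep y), 1:] i" for i
    unfolding matrix_char_poly_3[symmetric] red_char_poly_eq[OF scalar_hom_rep, symmetric]
    by (simp add: coeff_map_poly)
  from this[of 0] this[of 1] this[of 2] show "to_ac (trd \<kappa> y) = trace (rep y)"
    "to_ac (srd \<kappa> y) = minors_sum (rep y)" "to_ac (nrd \<kappa> y) = det (rep y)"
    by (simp_all add: trd_def srd_def nrd_def numeral_2_eq_2)
qed

lemma nrd_mult: "nrd \<kappa> (x * y) = nrd \<kappa> x * nrd \<kappa> y"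
  by (subst to_ac_eq_iff[symmetric], simp only: to_ac_mult to_ac_nrd rep_simps det_mul)

lemma nrd_1: "nrd \<kappa> 1 = 1"
  by (subst to_ac_eq_iff[symmetric], simp only: to_ac_1 to_ac_nrd rep_simps det_I)

lemma nrd_0: "nrd \<kappa> 0 = 0"
  by (subst to_ac_eq_iff[symmetric], simp add: to_ac_nrd rep_simps det_3)

lemma nrd_\<kappa>: "nrd \<kappa> (\<kappa> c) = c * c * c"
  by (subst to_ac_eq_iff[symmetric], simp add: to_ac_nrd rep_simps det_3 mat_def)

lemma nrd_inverse_mult: "x \<noteq> 0 \<Longrightarrow> nrd \<kappa> x * nrd \<kappa> (inverse x) = 1"
  by (simp flip: nrd_mult add: nrd_1)

lemma nrd_eq_0_iff: "nrd \<kappa> x = 0 \<longleftrightarrow> x = 0"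
  using nrd_inverse_mult[of x] nrd_0 by fastforce

lemma trd_add: "trd \<kappa> (x + y) = trd \<kappa> x + trd \<kappa> y"
  by (subst to_ac_eq_iff[symmetric], simp add: to_ac_trd rep_simps trace_def sum.distrib)

lemma trd_diff: "trd \<kappa> (x - y) = trd \<kappa> x - trd \<kappa> y"
  using trd_add[of "x - y" y] by simp

lemma trd_0: "trd \<kappa> 0 = 0"
  by (subst to_ac_eq_iff[symmetric], simp add: to_ac_trd rep_simps trace_def)

lemma trd_\<kappa>_mult: "trd \<kappa> (\<kappa> c * x) = c * trd \<kappa> x"
  by (subst to_ac_eq_iff[symmetric], simp add: to_ac_trd rep_simps trace_def sum_distrib_left)

lemma trd_\<kappa>: "trd \<kappa> (\<kappa> c) = c + c + c"
  by (subst to_ac_eq_iff[symmetric], simp add: to_ac_trd rep_simps trace_def sum_3 mat_def)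

lemma trd_commute: "trd \<kappa> (x * y) = trd \<kappa> (y * x)"
  by (subst to_ac_eq_iff[symmetric], simp add: to_ac_trd rep_simps trace_def sum_3 matrix_matrix_mult_def algebra_simps)

lemma trd_conj: "x \<noteq> 0 \<Longrightarrow> trd \<kappa> (x * y * inverse x) = trd \<kappa> y"
  using trd_commute[of "x * y" "inverse x"] by (simp add: mult.assoc[symmetric])

lemma srd_add: "srd \<kappa> (x + y) = srd \<kappa> x + srd \<kappa> y + trd \<kappa> x * trd \<kappa> y - trd \<kappa> (x * y)"
  by (subst to_ac_eq_iff[symmetric],
      simp only: to_ac_add to_ac_diff to_ac_mult to_ac_srd to_ac_trd rep_simps minors_sum_add)

lemma trd_square: "trd \<kappa> (x\<^sup>2) = trd \<kappa> x * trd \<kappa> x - srd \<kappa> x - srd \<kappa> x"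
  by (subst to_ac_eq_iff[symmetric], simp add: to_ac_srd to_ac_trd power2_eq_square rep_simps trace_def sum_3
      matrix_matrix_mult_def minors_sum_def algebra_simps)

lemma srd_0: "srd \<kappa> 0 = 0"
  by (subst to_ac_eq_iff[symmetric], simp add: to_ac_srd rep_simps minors_sum_def)

lemma cayley_hamilton:
  "x ^ 3 = \<kappa> (trd \<kappa> x) * x\<^sup>2 - \<kappa> (srd \<kappa> x) * x + \<kappa> (nrd \<kappa> x)"
proof -
  have "rep (x ^ 3) = rep x ** rep x ** rep x"
    by (simp add: power3_eq_cube rep_simps matrix_mul_assoc)
  also have "\<dots> = rep (\<kappa> (trd \<kappa> x) * x\<^sup>2 - \<kappa> (srd \<kappa> x) * x + \<kappa> (nrd \<kappa> x))"
    by (subst cayley_hamilton_3) (simp add: power2_eq_square rep_simps to_ac_trd to_ac_srd to_ac_nrd)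
  finally show ?thesis by (simp only: rep_inject)
qed

lemma cayley_hamilton_linearized:
  "x * x * y + x * y * x + y * x * x
    = \<kappa> (trd \<kappa> y) * (x * x) + \<kappa> (trd \<kappa> x) * (x * y + y * x) - \<kappa> (srd \<kappa> x) * y
      - \<kappa> (trd \<kappa> x * trd \<kappa> y - trd \<kappa> (x * y)) * x
      + \<kappa> (trd \<kappa> (x * x * y) - trd \<kappa> x * trd \<kappa> (x * y) + srd \<kappa> x * trd \<kappa> y)"
proof -
  have "rep (x * x * y + x * y * x + y * x * x)
      = rep x ** rep x ** rep y + rep x ** rep y ** rep x + rep y ** rep x ** rep x"
    by (simp only: rep_simps)
  also have "\<dots> = rep (\<kappa> (trd \<kappa> y) * (x * x) + \<kappa> (trd \<kappa> x) * (x * y + y * x) - \<kappa> (srd \<kappa> x) * y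
      - \<kappa> (trd \<kappa> x * trd \<kappa> y - trd \<kappa> (x * y)) * x
      + \<kappa> (trd \<kappa> (x * x * y) - trd \<kappa> x * trd \<kappa> (x * y) + srd \<kappa> x * trd \<kappa> y))"
    by (simp only: cayley_hamilton_3_linearized rep_simps to_ac_trd to_ac_srd to_ac_diff to_ac_add to_ac_mult)
  finally show ?thesis by (simp only: rep_inject)
qed

lemma mult_adj: "x * adj \<kappa> x = \<kappa> (nrd \<kappa> x)"
  using cayley_hamilton[of x]
  by (simp add: adj_def algebra_simps power2_eq_square power3_eq_cube \<kappa>_left_commute[of x] \<kappa>_commute[of _ x, symmetric])

lemma adj_eq: "x \<noteq> 0 \<Longrightarrow> adj \<kappa> x = \<kappa> (nrd \<kappa> x) * inverse x"
proof -
  assume "x \<noteq> 0"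
  have "adj \<kappa> x = inverse x * (x * adj \<kappa> x)" using \<open>x \<noteq> 0\<close> by (simp flip: mult.assoc)
  then show ?thesis by (simp add: mult_adj \<kappa>_commute)
qed

lemma adj_0: "adj \<kappa> 0 = 0"
  by (simp add: adj_def srd_0)

lemma adj_mult: "adj \<kappa> (x * y) = adj \<kappa> y * adj \<kappa> x"
proof (cases "x = 0 \<or> y = 0")
  case True
  then show ?thesis by (auto simp: adj_0)
next
  case False
  then have "adj \<kappa> (x * y) = \<kappa> (nrd \<kappa> x * nrd \<kappa> y) * (inverse y * inverse x)"
    by (simp add: adj_eq nrd_mult nonzero_inverse_mult_distrib)
  also have "\<dots> = (\<kappa> (nrd \<kappa> y) * inverse y) * (\<kappa> (nrd \<kappa> x) * inverse x)"
    by (simp add: \<kappa>_left_commute[of "inverse y"] mult.assoc mult.commute[of "nrd \<kappa> x"] del: \<kappa>_mult)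
       (simp add: mult.assoc)
  finally show ?thesis using False by (simp add: adj_eq)
qed

lemma adj_add:
  "adj \<kappa> (x + y) - adj \<kappa> x - adj \<kappa> y = x * y + y * x - \<kappa> (trd \<kappa> x) * y - \<kappa> (trd \<kappa> y) * x
     + \<kappa> (trd \<kappa> x * trd \<kappa> y - trd \<kappa> (x * y))"
  by (simp add: adj_def trd_add srd_add power2_eq_square algebra_simps)

lemma trd_adj: "trd \<kappa> (adj \<kappa> x) = srd \<kappa> x"
  by (simp add: adj_def trd_add trd_diff trd_square trd_\<kappa>_mult trd_\<kappa>)

text \<open>The quadratic operator of the Jordan algebra of \<open>B\<close> is \<open>b \<mapsto> a * b * a\<close>: this is the
  Cayley-Hamilton identity, linearized.\<close>

lemma jordan_U_operator:
  "\<kappa> (trd \<kappa> (a * b)) * a - (adj \<kappa> (adj \<kappa> a + b) - adj \<kappa> (adj \<kappa> a) - adj \<kappa> b) = a * b * a"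
proof -
  define t s where "t = trd \<kappa> a" and "s = srd \<kappa> a"
  have adj: "adj \<kappa> a = a * a - \<kappa> t * a + \<kappa> s" by (simp add: adj_def t_def s_def power2_eq_square)
  have tr: "trd \<kappa> (adj \<kappa> a * b) = trd \<kappa> (a * a * b) - t * trd \<kappa> (a * b) + s * trd \<kappa> b"
    unfolding adj by (simp add: distrib_right left_diff_distrib mult.assoc trd_add trd_diff trd_\<kappa>_mult)
  have "a * b * a = (a * a * b + a * b * a + b * a * a) - a * a * b - b * a * a" by simp
  also have "\<dots> = \<kappa> (trd \<kappa> b) * (a * a) + \<kappa> t * (a * b + b * a) - \<kappa> s * b
      - \<kappa> (t * trd \<kappa> b - trd \<kappa> (a * b)) * a
      + \<kappa> (trd \<kappa> (a * a * b) - t * trd \<kappa> (a * b) + s * trd \<kappa> b) - a * a * b - b * a * a"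
    unfolding cayley_hamilton_linearized t_def s_def ..
  also have "\<dots> = \<kappa> (trd \<kappa> (a * b)) * a - (adj \<kappa> a * b + b * adj \<kappa> a - \<kappa> s * b - \<kappa> (trd \<kappa> b) * adj \<kappa> a
     + \<kappa> (s * trd \<kappa> b - (trd \<kappa> (a * a * b) - t * trd \<kappa> (a * b) + s * trd \<kappa> b)))"
    unfolding adj
    by (simp add: algebra_simps \<kappa>_left_commute[of b] \<kappa>_commute[of _ b, symmetric] \<kappa>_commute[of t "\<kappa> _"] \<kappa>_commute[of s "\<kappa> _"])
  finally show ?thesis unfolding adj_add trd_adj tr s_def[symmetric] ..
qed

section \<open>Elements of reduced norm one are commutators\<close>

text \<open>Any \<open>g = x\<^sup>2 * b + x * b * y + b * y\<^sup>2\<close> intertwines \<open>x\<close> and \<open>y\<close>.  If it vanished for all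
  \<open>b\<close>, comparing its value at \<open>b * z\<close> with its value at \<open>b\<close> multiplied by \<open>z\<close> on the right,
  where \<open>z\<close> does not commute with \<open>y\<close>, would make \<open>x\<close> central.\<close>

lemma same_central_cube_imp_conjugate:
  assumes x: "x \<notin> range \<kappa>" and y: "y \<notin> range \<kappa>"
    and x3: "x ^ 3 = \<kappa> c" and y3: "y ^ 3 = \<kappa> c"
  obtains g where "g \<noteq> 0" "x * g = g * y"
proof -
  define F where "F b = x * x * b + x * b * y + b * y * y" for b
  have xF: "x * F b = F b * y" for b
  proof -
    have "x * F b - F b * y = x ^ 3 * b - b * y ^ 3"
      by (simp add: F_def algebra_simps power3_eq_cube)
    then show ?thesis unfolding x3 y3 by (simp add: \<kappa>_commute)
  qed
  have "\<exists>b. F b \<noteq> 0"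
  proof (rule ccontr)
    assume "\<nexists>b. F b \<noteq> 0"
    then have F0: "F b = 0" for b by blast
    obtain z where z: "y * z \<noteq> z * y" using y in_range_\<kappa>_iff by blast
    define w where "w = z * y - y * z"
    have "w \<noteq> 0" using z by (simp add: w_def)
    have rel: "x * b * w = - (b * (z * y * y - y * y * z))" for b
    proof -
      have "F (b * z) - F b * z = x * b * w + b * (z * y * y - y * y * z)"
        by (simp add: F_def w_def algebra_simps)
      then show ?thesis using F0 by (simp add: add_eq_0_iff2)
    qed
    have "x * b = b * x" for b
    proof -
      have "x * b * w = b * (x * 1 * w)" unfolding rel by (simp add: algebra_simps)
      then have "(x * b) * w = (b * x) * w" by (simp add: mult.assoc)
      then show ?thesis using \<open>w \<noteq> 0\<close> by simp
    qed
    then show False using x in_range_\<kappa>_iff by blast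
  qed
  then show thesis using that xF by blast
qed

text \<open>The factors of a product equal to 1 can be permuted cyclically, so \<open>a3\<close>, and hence also
  \<open>a1 + a2\<close>, commutes with \<open>a2 * a1\<close>.  Expanding this gives the claim.\<close>

lemma commutator_intertwines:
  assumes sum: "a1 + a2 + a3 = \<kappa> t" and prod: "a3 * a2 * a1 = 1"
  shows "(a1 * a2 - a2 * a1) * a1 = a2 * (a1 * a2 - a2 * a1)"
proof -
  have "a3 * (a2 * a1) = 1" using prod by (simp add: mult.assoc)
  then have "(a2 * a1) * a3 = 1"
    by (metis inverse_unique left_inverse mult_zero_left zero_neq_one)
  then have "a3 * (a2 * a1) = (a2 * a1) * a3" using prod by (simp add: mult.assoc)
  moreover have "a3 = \<kappa> t - a1 - a2" using sum by (simp add: algebra_simps)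
  ultimately have "(\<kappa> t - a1 - a2) * (a2 * a1) = (a2 * a1) * (\<kappa> t - a1 - a2)" by simp
  then show ?thesis by (simp add: algebra_simps \<kappa>_commute[of t "a2 * _"])
qed

text \<open>Wedderburn's factorization of the characteristic polynomial of \<open>p\<close> into conjugate linear
  factors, read off at its last two coefficients.  The cofactor of \<open>X - p\<close> is
  \<open>X\<^sup>2 + (p - t) X + (p\<^sup>2 - t p + s)\<close>; its value at \<open>p2\<close>, multiplied by \<open>e\<close>, is the commutator of
  \<open>p\<^sup>3 - t p\<^sup>2 + s p\<close> with \<open>d\<close>, which is 0 because that element is central.\<close>

lemma wedderburn_factors:
  assumes n: "nrd \<kappa> p = 1" and e: "e = p * d - d * p" "e \<noteq> 0"
  defines "p2 \<equiv> e * p * inverse e" and "p3 \<equiv> \<kappa> (trd \<kappa> p) - p - e * p * inverse e"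
  shows "p3 * p2 = p * p - \<kappa> (trd \<kappa> p) * p + \<kappa> (srd \<kappa> p)" "p3 * p2 * p = 1"
proof -
  let ?t = "\<kappa> (trd \<kappa> p)" and ?s = "\<kappa> (srd \<kappa> p)"
  have c: "p * (p * p) = ?t * (p * p) - ?s * p + 1"
    using cayley_hamilton[of p] n by (simp add: power3_eq_cube power2_eq_square mult.assoc)
  have ch: "p * p * p = ?t * (p * p) - ?s * p + 1" using c by (simp add: mult.assoc)
  have p2e: "p2 * e = e * p" using e by (simp add: p2_def mult.assoc)
  have "(p2 * p2 + (p - ?t) * p2 + (p * p - ?t * p + ?s)) * e
      = e * p * p + (p - ?t) * (e * p) + (p * p - ?t * p + ?s) * e"
    by (simp add: distrib_right mult.assoc p2e) (simp flip: mult.assoc add: p2e)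
  also have "\<dots> = (p * p * p - ?t * (p * p) + ?s * p) * d - d * (p * p * p - ?t * (p * p) + ?s * p)"
    unfolding e by (simp add: algebra_simps \<kappa>_left_commute[of p] \<kappa>_left_commute[of d] \<kappa>_commute[of _ p, symmetric] \<kappa>_commute[of _ d, symmetric])
  also have "\<dots> = 0" unfolding ch by simp
  finally have g: "p2 * p2 + (p - ?t) * p2 + (p * p - ?t * p + ?s) = 0" using e(2) by simp
  have "p3 * p2 = - (p2 * p2) - (p - ?t) * p2"
    unfolding p3_def p2_def[symmetric] by (simp add: algebra_simps)
  also have "\<dots> = p * p - ?t * p + ?s" using g by (simp add: algebra_simps eq_neg_iff_add_eq_0)
  finally show p32: "p3 * p2 = p * p - ?t * p + ?s" .
  show "p3 * p2 * p = 1" unfolding p32 by (simp add: distrib_right left_diff_distrib mult.assoc c)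
qed

text \<open>The cube commutes with \<open>x\<close> and with \<open>p\<close>.  If it were not central, \<open>x\<close> and \<open>p\<close> would commute with
  each other.\<close>

lemma cyclic_conjugator_cube_central:
  assumes x: "x \<noteq> 0" "x * p \<noteq> p * x"
    and cyc: "x * p = p2 * x" "x * p2 = p3 * x" "x * p3 = p * x"
  shows "x ^ 3 \<in> range \<kappa>"
proof (rule ccontr)
  assume w: "x ^ 3 \<notin> range \<kappa>"
  have "x ^ 3 * p = x * (x * (x * p))" by (simp add: power3_eq_cube mult.assoc)
  also have "\<dots> = x * (x * p2) * x" by (simp only: cyc(1) mult.assoc)
  also have "\<dots> = (x * p3) * x * x" by (simp add: cyc(2) mult.assoc)
  also have "\<dots> = p * x ^ 3" by (simp add: cyc(3) power3_eq_cube mult.assoc)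
  finally have "p * x ^ 3 = x ^ 3 * p" ..
  moreover have "x * x ^ 3 = x ^ 3 * x" by (simp add: power3_eq_cube mult.assoc)
  ultimately show False using commute_trans[OF w] x(2) by metis
qed

lemma central_quadratic_relation_False:
  assumes p: "p \<notin> range \<kappa>" and c: "\<kappa> c * ((\<kappa> d - p) * p) = 1"
  shows False
proof -
  have "\<kappa> (- 1) + \<kappa> (c * d) * p + \<kappa> (- c) * p\<^sup>2 = 0"
    using c by (simp add: algebra_simps power2_eq_square)
  from quadratic_relation_trivial[OF p this] show False by simp
qed

text \<open>If \<open>e\<close> commuted with \<open>p\<close>, then \<open>d' = d * inverse e\<close> would satisfy \<open>p * d' - d' * p = 1\<close>, and every
  \<open>w\<close> commuting with \<open>p\<close> would be the additive commutator of \<open>p\<close> and \<open>d' * w\<close>, hence of trace 0.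
  For \<open>w\<close> equal to 1, \<open>p\<close> and the adjoint of \<open>p\<close> this says that the characteristic is 3 and that
  \<open>p\<^sup>3 = 1\<close>, so \<open>(p - 1)\<^sup>3 = 0\<close>.\<close>

lemma commutator_not_commuting:
  assumes p: "p \<notin> range \<kappa>" and n: "nrd \<kappa> p = 1" and e: "e = p * d - d * p" "e \<noteq> 0"
  shows "e * p \<noteq> p * e"
proof
  assume ep: "e * p = p * e"
  define d' where "d' = d * inverse e"
  have ie: "inverse e * p = p * inverse e"
    using ep e(2) by (metis mult.assoc mult_1_left mult_1_right left_inverse right_inverse)
  have one: "p * d' - d' * p = 1"
  proof -
    have "p * d' - d' * p = (p * d - d * p) * inverse e"
      by (simp add: d'_def left_diff_distrib mult.assoc ie)
    then show ?thesis using e by simp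
  qed
  have tr: "trd \<kappa> w = 0" if "w * p = p * w" for w
  proof -
    have "w = (p * d' - d' * p) * w" using one by simp
    also have "\<dots> = p * (d' * w) - d' * w * p" using that by (simp add: left_diff_distrib mult.assoc)
    finally have "trd \<kappa> w = trd \<kappa> (p * (d' * w) - (d' * w) * p)" by simp
    then show ?thesis by (simp add: trd_diff trd_commute[of p])
  qed
  have t: "trd \<kappa> p = 0" by (rule tr) simp
  have three: "(1 + 1 + 1 :: 'K) = 0" using tr[of 1] trd_\<kappa>[of 1] by simp
  have "adj \<kappa> p * p = p * adj \<kappa> p"
    by (simp add: adj_def algebra_simps power2_eq_square \<kappa>_commute[of _ p, symmetric] \<kappa>_left_commute[of p])
  then have s: "srd \<kappa> p = 0" using tr trd_adj by metis
  have p3: "p ^ 3 = 1" using cayley_hamilton[of p] by (simp add: t s n)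
  have three_0: "w + w + w = 0" for w :: 'b
  proof -
    have "w + w + w = \<kappa> (1 + 1 + 1) * w" by (simp only: \<kappa>_add \<kappa>_1 distrib_right mult_1_left)
    then show ?thesis unfolding three by simp
  qed
  have "(p - 1) ^ 3 = p ^ 3 - (p * p + p * p + p * p) + (p + p + p) - 1"
    by (simp add: power3_eq_cube algebra_simps)
  also have "\<dots> = 0" unfolding three_0 p3 by simp
  finally have "(p - 1) ^ 3 = 0" .
  then have "p = \<kappa> 1" by simp
  then show False using p by (metis rangeI)
qed

lemma nrd_conj: "x \<noteq> 0 \<Longrightarrow> nrd \<kappa> (x * y * inverse x) = nrd \<kappa> y"
  using nrd_inverse_mult[of x] by (simp add: nrd_mult)

text \<open>The second coefficient is the trace of the adjoint; the expression through \<open>trd \<kappa> (x\<^sup>2)\<close> would not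
  determine it in characteristic 2.\<close>

lemma srd_conj:
  assumes "x \<noteq> 0"
  shows "srd \<kappa> (x * y * inverse x) = srd \<kappa> y"
proof -
  have "adj \<kappa> x * adj \<kappa> (inverse x) = 1"
    using adj_mult[of "inverse x" x] adj_eq[of 1] assms by (simp add: nrd_1)
  then have "trd \<kappa> (adj \<kappa> (inverse x) * (adj \<kappa> y * adj \<kappa> x)) = trd \<kappa> (adj \<kappa> y)"
    by (subst trd_commute) (simp add: mult.assoc)
  then show ?thesis by (simp add: trd_adj[symmetric] adj_mult)
qed

lemma commuting_linear_factors:
  fixes a b c d :: 'b
  assumes "a * c = c * a" "a * d = d * a"
  shows "(a - b) * (a - c) * (a - d)
    = a * a * a - (d + c + b) * (a * a) + (b * c + (c + b) * d) * a - b * c * d"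
proof -
  have "a * (c * v) = c * (a * v)" "a * (d * v) = d * (a * v)" for v
    using assms by (metis mult.assoc)+
  then show ?thesis using assms by (simp add: algebra_simps)
qed

text \<open>Let \<open>p3, p2, p\<close> be the factors given by a commutator \<open>e\<close>.  If \<open>p\<close> and \<open>p2\<close> do not commute, their
  additive commutator is \<open>x\<close>, since it does not change when \<open>p, p2, p3\<close> are permuted cyclically.  If
  they commute, then \<open>K(p)\<close> contains all roots, and \<open>x\<close> is \<open>e\<close>: conjugation by \<open>e\<close> is an
  automorphism of \<open>K(p)\<close> of order 3.\<close>

lemma cyclic_conjugator_exists:
  assumes p: "p \<notin> range \<kappa>" and n: "nrd \<kappa> p = 1"
  obtains x p2 p3 where "x \<noteq> 0" "x * p \<noteq> p * x" "x * p = p2 * x" "x * p2 = p3 * x"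
    "x * p3 = p * x" "p3 * p2 * p = 1"
proof -
  obtain d where "p * d \<noteq> d * p" using p in_range_\<kappa>_iff by blast
  then obtain e where e: "e = p * d - d * p" "e \<noteq> 0" by simp
  define p2 where "p2 = e * p * inverse e"
  define p3 where "p3 = \<kappa> (trd \<kappa> p) - p - p2"
  have p32: "p3 * p2 = p * p - \<kappa> (trd \<kappa> p) * p + \<kappa> (srd \<kappa> p)" and prod: "p3 * p2 * p = 1"
    using wedderburn_factors[OF n e] unfolding p3_def p2_def by simp_all
  have sum: "p + p2 + p3 = \<kappa> (trd \<kappa> p)" by (simp add: p3_def)
  have ep: "e * p = p2 * e" using e(2) by (simp add: p2_def mult.assoc)
  have ncomm: "e * p \<noteq> p * e" by (rule commutator_not_commuting[OF p n e])
  have "p2 \<noteq> p" using ep ncomm by auto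
  show thesis
  proof (cases "p * p2 = p2 * p")
    case False
    define x where "x = p * p2 - p2 * p"
    have "x \<noteq> 0" using False by (simp add: x_def)
    have x1: "x * p = p2 * x" unfolding x_def by (rule commutator_intertwines[OF sum prod])
    have "p3 * (p2 * p) = 1" using prod by (simp add: mult.assoc)
    then have prod': "p2 * p * p3 = 1"
      by (metis inverse_unique left_inverse mult_zero_left zero_neq_one)
    have p3_alt: "p3 = \<kappa> (trd \<kappa> p) - p - p2" by (simp add: p3_def)
    have "p2 * (p * p3) = 1" using prod' by (simp add: mult.assoc)
    then have prod'': "p * p3 * p2 = 1"
      by (metis inverse_unique left_inverse mult_zero_left zero_neq_one)
    have x': "p2 * p3 - p3 * p2 = x" "p3 * p - p * p3 = x"
      unfolding p3_alt x_def by (simp_all add: algebra_simps \<kappa>_commute[of _ p2] \<kappa>_commute[of _ p])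
    have "(p2 * p3 - p3 * p2) * p2 = p3 * (p2 * p3 - p3 * p2)"
      by (rule commutator_intertwines[of p2 p3 p "trd \<kappa> p"]) (use sum prod'' in \<open>simp_all add: algebra_simps\<close>)
    then have x2: "x * p2 = p3 * x" unfolding x' .
    have "(p3 * p - p * p3) * p3 = p * (p3 * p - p * p3)"
      by (rule commutator_intertwines[of p3 p p2 "trd \<kappa> p"]) (use sum prod' in \<open>simp_all add: algebra_simps\<close>)
    then have x3: "x * p3 = p * x" unfolding x' .
    have "x * p \<noteq> p * x" using x1 \<open>x \<noteq> 0\<close> \<open>p2 \<noteq> p\<close> by auto
    then show thesis using that[of x p2 p3] \<open>x \<noteq> 0\<close> x1 x2 x3 prod by simp
  next
    case True
    \<comment> \<open>The conjugate \<open>p4\<close> of \<open>p2\<close> is a root of the same cubic, which splits in \<open>K(p)\<close>, and only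
      the root \<open>p3\<close> is possible.\<close>
    define p4 where "p4 = e * p2 * inverse e"
    have ep2: "e * p2 = p4 * e" using e(2) by (simp add: p4_def mult.assoc)
    have p2c: "p2 \<notin> range \<kappa>"
    proof
      assume "p2 \<in> range \<kappa>"
      then have "e * p2 = p2 * e" using in_range_\<kappa>_iff by auto
      then have "e * p2 = e * p" using ep by simp
      then show False using e(2) \<open>p2 \<noteq> p\<close> by simp
    qed
    have p4_p2: "p4 * p2 = p2 * p4"
    proof -
      have "p4 * p2 * e = e * (p2 * p)" by (simp add: mult.assoc ep[symmetric]) (simp add: mult.assoc[symmetric] ep2)
      also have "\<dots> = p2 * p4 * e" unfolding True[symmetric] by (simp add: mult.assoc ep2[symmetric]) (simp add: mult.assoc[symmetric] ep)
      finally show ?thesis using e(2) by simp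
    qed
    have p4_p: "p4 * p = p * p4" by (rule commute_trans[OF p2c p4_p2 True])
    have "(p4 - p3) * (p4 - p2) * (p4 - p) = 0"
    proof -
      have "(p4 - p3) * (p4 - p2) * (p4 - p) = p4 * p4 * p4 - (p + p2 + p3) * (p4 * p4)
          + (p3 * p2 + (p2 + p3) * p) * p4 - p3 * p2 * p"
        by (rule commuting_linear_factors[OF p4_p2 p4_p])
      also have "(p2 + p3) * p = \<kappa> (trd \<kappa> p) * p - p * p"
        unfolding p3_def by (simp add: algebra_simps)
      also have "p3 * p2 + \<dots> = \<kappa> (srd \<kappa> p)"
        unfolding p32 by simp
      also have "p4 * p4 * p4 - (p + p2 + p3) * (p4 * p4) + \<kappa> (srd \<kappa> p) * p4 - p3 * p2 * p = 0"
      proof -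
        have "trd \<kappa> p4 = trd \<kappa> p" "nrd \<kappa> p4 = 1" "srd \<kappa> p4 = srd \<kappa> p"
          using e(2) by (simp_all add: p4_def p2_def trd_conj nrd_conj srd_conj n)
        then show ?thesis using cayley_hamilton[of p4]
          unfolding sum prod by (simp add: power3_eq_cube power2_eq_square mult.assoc)
      qed
      finally show ?thesis .
    qed
    then consider "p4 = p3" | "p4 = p2" | "p4 = p" by auto
    then show thesis
    proof cases
      case 1
      have e2: "e * p2 = p3 * e" using ep2 1 by simp
      have "e * p3 = e * \<kappa> (trd \<kappa> p) - e * p - e * p2" by (simp add: p3_def right_diff_distrib)
      also have "\<dots> = (\<kappa> (trd \<kappa> p) - p2 - p3) * e" by (simp add: ep e2 \<kappa>_commute left_diff_distrib)
      also have "\<kappa> (trd \<kappa> p) - p2 - p3 = p" using sum by (simp add: algebra_simps)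
      finally show thesis using that[of e p2 p3] e(2) ncomm ep e2 prod by simp
    next
      case 2
      then have "e * p2 = e * p" using ep ep2 by simp
      then show thesis using e(2) \<open>p2 \<noteq> p\<close> by simp
    next
      case 3
      have "(p + p2) * e = e * (p + p2)" using 3 ep ep2 by (simp add: algebra_simps)
      moreover have "(p + p2) * p = p * (p + p2)" using True by (simp add: algebra_simps)
      ultimately have "p + p2 \<in> range \<kappa>" using commute_trans ncomm by metis
      then obtain c where c: "p + p2 = \<kappa> c" by auto
      then have "p2 = \<kappa> c - p" by (simp add: eq_diff_eq add.commute)
      moreover have "p3 = \<kappa> (trd \<kappa> p - c)" using sum c by (simp add: algebra_simps)
      ultimately have "\<kappa> (trd \<kappa> p - c) * ((\<kappa> c - p) * p) = 1" using prod by (simp add: mult.assoc)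
      then have False by (rule central_quadratic_relation_False[OF p])
      then show thesis ..
    qed
  qed
qed

text \<open>With \<open>p = x * v\<close>, moving every \<open>x\<close> to the left in \<open>p3 * p2 * p = 1\<close> gives \<open>x\<^sup>3 * v\<^sup>3 = 1\<close>.  So \<open>v\<close> is
  conjugate to \<open>inverse x\<close>.\<close>

theorem noncentral_norm_one_is_commutator:
  assumes p: "p \<notin> range \<kappa>" and n: "nrd \<kappa> p = 1"
  obtains x g where "x \<noteq> 0" "g \<noteq> 0" "p = x * g * inverse x * inverse g"
proof -
  obtain x p2 p3 where x: "x \<noteq> 0" "x * p \<noteq> p * x" and cyc: "x * p = p2 * x" "x * p2 = p3 * x"
      "x * p3 = p * x" and prod: "p3 * p2 * p = 1"
    using cyclic_conjugator_exists[OF p n] .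
  obtain w where w: "x ^ 3 = \<kappa> w"
    using cyclic_conjugator_cube_central[OF x cyc] by auto
  define y where "y = inverse p * x"
  have "p \<noteq> 0" using n nrd_0 by auto
  then have py: "p * y = x" by (simp add: y_def mult.assoc[symmetric])
  have yc: "y \<notin> range \<kappa>"
  proof
    assume "y \<in> range \<kappa>"
    then have "y * p = p * y" using in_range_\<kappa>_iff by auto
    then have "x * p = p * x" using py by (metis mult.assoc)
    then show False using x by simp
  qed
  have xc: "x \<notin> range \<kappa>" using x(2) in_range_\<kappa>_iff by auto
  define v where "v = inverse y"
  have "y \<noteq> 0" using py x(1) by auto
  have pv: "p = x * v" using py \<open>y \<noteq> 0\<close> unfolding v_def by (metis mult.assoc mult_1_right right_inverse)
  have p2x: "p2 * x = x * x * v" using cyc(1) pv by (simp add: mult.assoc)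
  have p3xx: "p3 * x * x = x * x * x * v"
    using p2x by (simp add: cyc(2)[symmetric] mult.assoc)
  have "1 = p3 * (p2 * x) * v" using prod pv by (simp add: mult.assoc)
  also have "\<dots> = (p3 * x * x) * v * v" unfolding p2x by (simp add: mult.assoc)
  finally have "x * x * x * v * v * v = 1" unfolding p3xx by simp
  then have "x * x * x * v * v * v * (y * y * y) = y * y * y" by simp
  moreover have "v * v * v * (y * y * y) = 1"
    using \<open>y \<noteq> 0\<close> by (simp add: v_def mult.assoc) (simp add: mult.assoc[symmetric])
  ultimately have "y ^ 3 = x ^ 3" by (simp add: power3_eq_cube mult.assoc)
  then obtain g where g: "g \<noteq> 0" "x * g = g * y"
    using same_central_cube_imp_conjugate[OF xc yc, of w] w by auto
  have "y = inverse g * (x * g)" using g by (simp add: mult.assoc[symmetric])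
  then have "v = inverse g * inverse x * g"
    using g(1) x(1) by (simp add: v_def nonzero_inverse_mult_distrib)
  then have "p = x * inverse g * inverse x * inverse (inverse g)"
    using g(1) by (simp add: pv mult.assoc)
  then show thesis using that[of x "inverse g"] x(1) g(1) by simp
qed

end

section \<open>Products of Hermitian elements\<close>

context unitary_division_algebra
begin

sublocale cubic_division_algebra \<kappa> ..

lemma \<sigma>_0 [simp]: "\<sigma> 0 = 0"
  using \<sigma>_add[of 0 0] by simp

lemma \<sigma>_minus: "\<sigma> (- x) = - \<sigma> x"
  using \<sigma>_add[of "- x" x] by (simp add: eq_neg_iff_add_eq_0)

lemma \<sigma>_diff: "\<sigma> (x - y) = \<sigma> x - \<sigma> y"
  using \<sigma>_add[of x "- y"] by (simp add: \<sigma>_minus)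

lemma \<sigma>_inject: "\<sigma> x = \<sigma> y \<longleftrightarrow> x = y"
  by (metis \<sigma>_invol)

lemma \<sigma>_eq_0_iff [simp]: "\<sigma> x = 0 \<longleftrightarrow> x = 0"
  using \<sigma>_inject[of x 0] by simp

lemma \<sigma>_1 [simp]: "\<sigma> 1 = 1"
  using \<sigma>_\<kappa>[of 1] bar_hom by (simp add: unital_ring_hom_def)

lemma \<sigma>_inverse: "\<sigma> (inverse x) = inverse (\<sigma> x)"
proof (cases "x = 0")
  case False
  have "\<sigma> x * \<sigma> (inverse x) = 1" using False by (simp flip: \<sigma>_mult)
  then show ?thesis by (rule inverse_unique[symmetric])
qed simp

lemma bar_bar: "bar (bar c) = c"
  using \<sigma>_invol[of "\<kappa> c"] by (simp add: \<sigma>_\<kappa>)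

lemma bar_diff: "bar (x - y) = bar x - bar y"
  using bar_hom unfolding unital_ring_hom_def by (metis add_diff_cancel diff_add_cancel)

lemma skew_scalar_exists: "\<exists>\<epsilon>. \<epsilon> \<noteq> 0 \<and> bar \<epsilon> = - \<epsilon>"
proof -
  obtain \<theta> where "bar \<theta> \<noteq> \<theta>" using bar_nontrivial by fastforce
  then show ?thesis by (intro exI[of _ "\<theta> - bar \<theta>"]) (simp add: bar_diff bar_bar)
qed

inductive_set herm_products :: "'b set" where
  herm: "h \<in> Herm \<sigma> \<Longrightarrow> h \<noteq> 0 \<Longrightarrow> h \<in> herm_products"
| mult: "h \<in> Herm \<sigma> \<Longrightarrow> h \<noteq> 0 \<Longrightarrow> s \<in> herm_products \<Longrightarrow> h * s \<in> herm_products"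

lemma one_in_herm_products: "1 \<in> herm_products"
  by (rule herm) (simp_all add: Herm_def)

lemma herm_products_nonzero: "s \<in> herm_products \<Longrightarrow> s \<noteq> 0"
  by (induction rule: herm_products.induct) auto

lemma herm_products_mult: "s \<in> herm_products \<Longrightarrow> t \<in> herm_products \<Longrightarrow> s * t \<in> herm_products"
  by (induction rule: herm_products.induct) (auto intro: herm_products.mult simp: mult.assoc)

lemma herm_inverse: "h \<in> Herm \<sigma> \<Longrightarrow> inverse h \<in> Herm \<sigma>"
  by (simp add: Herm_def \<sigma>_inverse)

lemma herm_products_inverse: "s \<in> herm_products \<Longrightarrow> inverse s \<in> herm_products"
proof (induction rule: herm_products.induct)
  case (herm h)
  then show ?case by (intro herm_products.herm herm_inverse) auto
next
  case (mult h s)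
  have "inverse h \<in> herm_products" using mult.hyps by (intro herm herm_inverse) auto
  then have "inverse s * inverse h \<in> herm_products" by (rule herm_products_mult[OF mult.IH])
  then show ?case
    using mult.hyps herm_products_nonzero[of s] by (simp add: nonzero_inverse_mult_distrib)
qed

text \<open>Both \<open>w * h * \<sigma> w\<close> and \<open>w * \<sigma> w\<close> are Hermitian, so the products of Hermitian elements
  form a normal subgroup.\<close>

lemma herm_products_conj:
  assumes "s \<in> herm_products" "w \<noteq> 0"
  shows "w * s * inverse w \<in> herm_products"
  using assms(1)
proof (induction rule: herm_products.induct)
  case herm: (herm h)
  have "w * h * \<sigma> w \<in> herm_products"
    using herm assms(2) by (intro herm_products.herm) (auto simp: Herm_def \<sigma>_mult \<sigma>_invol mult.assoc)
  moreover have "inverse (w * \<sigma> w) \<in> herm_products"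
    using assms(2) by (intro herm_products.herm herm_inverse) (auto simp: Herm_def \<sigma>_mult \<sigma>_invol)
  ultimately have "w * h * \<sigma> w * inverse (w * \<sigma> w) \<in> herm_products" by (rule herm_products_mult)
  also have "w * h * \<sigma> w * inverse (w * \<sigma> w) = w * h * (\<sigma> w * inverse (\<sigma> w)) * inverse w"
    using assms(2) by (simp only: nonzero_inverse_mult_distrib \<sigma>_eq_0_iff not_False_eq_True mult.assoc)
  finally show ?case using assms(2) by simp
next
  case (mult h s)
  have "w * h * \<sigma> w \<in> herm_products"
    using mult assms(2) by (intro herm_products.herm) (auto simp: Herm_def \<sigma>_mult \<sigma>_invol mult.assoc)
  moreover have "inverse (w * \<sigma> w) \<in> herm_products"
    using assms(2) by (intro herm_products.herm herm_inverse) (auto simp: Herm_def \<sigma>_mult \<sigma>_invol)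
  ultimately have "w * h * \<sigma> w * inverse (w * \<sigma> w) \<in> herm_products" by (rule herm_products_mult)
  then have "w * h * \<sigma> w * inverse (w * \<sigma> w) * (w * s * inverse w) \<in> herm_products"
    by (rule herm_products_mult[OF _ mult.IH])
  also have "w * h * \<sigma> w * inverse (w * \<sigma> w) * (w * s * inverse w)
      = w * h * (\<sigma> w * inverse (\<sigma> w)) * (inverse w * w) * s * inverse w"
    using assms(2) by (simp only: nonzero_inverse_mult_distrib \<sigma>_eq_0_iff not_False_eq_True mult.assoc)
  finally show ?case using assms(2) by (simp add: mult.assoc)
qed

text \<open>By normality a factor from the subgroup can be dropped anywhere in a product.\<close>

lemma herm_products_cancel:
  assumes s: "s \<in> herm_products" and u: "u \<noteq> 0"
  shows "u * (s * v) \<in> herm_products \<longleftrightarrow> u * v \<in> herm_products"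
proof -
  have eq: "u * (t * w) = (u * t * inverse u) * (u * w)" for t w
    using u by (simp add: mult.assoc) (simp add: mult.assoc[symmetric])
  show ?thesis
  proof
    assume "u * v \<in> herm_products"
    then show "u * (s * v) \<in> herm_products"
      unfolding eq[of s] by (rule herm_products_mult[OF herm_products_conj[OF s u]])
  next
    assume "u * (s * v) \<in> herm_products"
    then have "u * (inverse s * (s * v)) \<in> herm_products"
      unfolding eq[of "inverse s"] by (rule herm_products_mult[OF herm_products_conj[OF herm_products_inverse[OF s] u]])
    then show "u * v \<in> herm_products"
      using herm_products_nonzero[OF s] by (simp add: mult.assoc[symmetric])
  qed
qed

text \<open>The map \<open>\<Gamma> b = x * b - b * \<sigma> x\<close> is linear over \<open>K\<close>, and \<open>\<Gamma> (\<sigma> b) = - \<sigma> (\<Gamma> b)\<close>.  If it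
  kills some \<open>b \<noteq> 0\<close>, it kills the Hermitian element \<open>b + \<sigma> b\<close>, or, when this is 0, the product of
  \<open>b\<close> with a skew scalar.  Otherwise it is onto, and the preimage of \<open>y - \<sigma> y\<close> is Hermitian by
  uniqueness.\<close>

lemma hermitian_multiplier:
  "(\<exists>h\<in>Herm \<sigma>. h \<noteq> 0 \<and> x * h \<in> Herm \<sigma>) \<or> (\<exists>h\<in>Herm \<sigma>. x * h - y \<in> Herm \<sigma>)"
proof -
  define \<Gamma> where "\<Gamma> b = x * b - b * \<sigma> x" for b
  have lin: "Vector_Spaces.linear (\<lambda>c x. \<kappa> c * x) (\<lambda>c x. \<kappa> c * x) \<Gamma>"
    unfolding Vector_Spaces.linear_iff using B.vector_space_axioms
    by (simp add: \<Gamma>_def distrib_left distrib_right right_diff_distrib \<kappa>_left_commute[of x] mult.assoc)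
  have \<Gamma>_\<sigma>: "\<sigma> (\<Gamma> b) = - \<Gamma> (\<sigma> b)" for b
    by (simp add: \<Gamma>_def \<sigma>_diff \<sigma>_mult \<sigma>_invol)
  show ?thesis
  proof (cases "inj \<Gamma>")
    case True
    then have "surj \<Gamma>" using B.linear_inj_imp_surj[OF lin] by blast
    then obtain b where b: "\<Gamma> b = y - \<sigma> y" by (metis surjD)
    have "\<Gamma> (\<sigma> b) = - \<sigma> (\<Gamma> b)" by (simp add: \<Gamma>_\<sigma>)
    also have "\<dots> = \<Gamma> b" unfolding b by (simp add: \<sigma>_diff \<sigma>_invol)
    finally have "\<sigma> b = b" using True by (rule injD[rotated])
    moreover have "\<sigma> (x * b - y) = x * b - y"
      using b \<open>\<sigma> b = b\<close> by (simp add: \<Gamma>_def \<sigma>_diff \<sigma>_mult algebra_simps)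
    ultimately show ?thesis by (auto simp: Herm_def)
  next
    case False
    interpret l: Vector_Spaces.linear "\<lambda>c x. \<kappa> c * x" "\<lambda>c x. \<kappa> c * x" \<Gamma> by (rule lin)
    obtain b where b: "b \<noteq> 0" "\<Gamma> b = 0" using False l.inj_iff_eq_0 by blast
    have "\<Gamma> (\<sigma> b) = 0" using \<Gamma>_\<sigma>[of b] b(2) by simp
    have "\<exists>h. h \<noteq> 0 \<and> \<sigma> h = h \<and> \<Gamma> h = 0"
    proof (cases "b + \<sigma> b = 0")
      case True
      then have sb: "\<sigma> b = - b" by (simp add: add_eq_0_iff)
      obtain \<epsilon> where \<epsilon>: "\<epsilon> \<noteq> 0" "bar \<epsilon> = - \<epsilon>" using skew_scalar_exists by blast
      have "\<sigma> (\<kappa> \<epsilon> * b) = \<kappa> \<epsilon> * b" using \<kappa>_commute[of \<epsilon> b] by (simp add: \<sigma>_mult \<sigma>_\<kappa> sb \<epsilon>)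
      moreover have "\<Gamma> (\<kappa> \<epsilon> * b) = 0" using l.scale[of \<epsilon> b] b(2) by simp
      ultimately show ?thesis using b(1) \<epsilon>(1) by (intro exI[of _ "\<kappa> \<epsilon> * b"]) simp
    next
      case False
      have "\<Gamma> (b + \<sigma> b) = 0" using l.add[of b "\<sigma> b"] b(2) \<open>\<Gamma> (\<sigma> b) = 0\<close> by simp
      then show ?thesis using False
        by (intro exI[of _ "b + \<sigma> b"]) (simp add: \<sigma>_add \<sigma>_invol add.commute)
    qed
    then obtain h where "h \<noteq> 0" "\<sigma> h = h" "x * h = h * \<sigma> x" by (auto simp: \<Gamma>_def)
    then show ?thesis by (auto simp: Herm_def \<sigma>_mult)
  qed
qed

text \<open>Modulo products of Hermitian elements, \<open>x\<close> can be replaced by \<open>y + g = g * (inverse g * y + 1)\<close>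
  with \<open>g\<close> Hermitian, hence by \<open>inverse g * y + 1\<close>, which commutes with \<open>inverse g * y\<close>.\<close>

theorem commutator_in_herm_products:
  assumes x: "x \<noteq> 0" and y: "y \<noteq> 0"
  shows "x * (y * (inverse x * inverse y)) \<in> herm_products"
proof (cases "y \<in> Herm \<sigma>")
  case True
  then have y': "y \<in> herm_products" "inverse y \<in> herm_products"
    using y by (auto intro: herm herm_inverse)
  have "x * y * inverse x * inverse y \<in> herm_products"
    by (rule herm_products_mult[OF herm_products_conj[OF y'(1) x] y'(2)])
  then show ?thesis by (simp add: mult.assoc)
next
  case False
  consider h where "h \<in> Herm \<sigma>" "h \<noteq> 0" "x * h \<in> Herm \<sigma>" | h where "h \<in> Herm \<sigma>" "x * h - y \<in> Herm \<sigma>"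
    using hermitian_multiplier[of x y] by blast
  then show ?thesis
  proof cases
    case 1
    have "(x * h) * inverse h \<in> herm_products"
      using 1 x by (intro herm_products_mult herm herm_inverse) auto
    then have xs: "x \<in> herm_products" using 1 by (simp add: mult.assoc)
    have "x * (y * inverse x * inverse y) \<in> herm_products"
      by (rule herm_products_mult[OF xs herm_products_conj[OF herm_products_inverse[OF xs] y]])
    then show ?thesis by (simp add: mult.assoc)
  next
    case 2
    define g where "g = x * h - y"
    have h: "h \<noteq> 0"
    proof
      assume "h = 0"
      then have "- y \<in> Herm \<sigma>" using 2(2) by simp
      then show False using False by (simp add: Herm_def \<sigma>_minus)
    qed
    have hS: "h \<in> herm_products" "inverse h \<in> herm_products"
      using 2(1) h by (auto intro: herm herm_inverse)
    define v where "v = y + g"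
    have xh: "x * h = v" by (simp add: v_def g_def)
    have "v \<noteq> 0" using xh x h by auto
    have x_eq: "x = v * inverse h" using xh h by (simp add: mult.assoc flip: xh)
    have ix: "inverse x = h * inverse v"
      using x_eq h \<open>v \<noteq> 0\<close> by (simp add: nonzero_inverse_mult_distrib)
    have "x * (y * (inverse x * inverse y)) \<in> herm_products
        \<longleftrightarrow> v * (inverse h * (y * (h * (inverse v * inverse y)))) \<in> herm_products"
      unfolding ix by (subst x_eq) (simp only: mult.assoc)
    also have "\<dots> \<longleftrightarrow> v * (y * (h * (inverse v * inverse y))) \<in> herm_products"
      by (rule herm_products_cancel[OF hS(2) \<open>v \<noteq> 0\<close>])
    also have "\<dots> \<longleftrightarrow> (v * y) * (h * (inverse v * inverse y)) \<in> herm_products"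
      by (simp only: mult.assoc)
    also have "\<dots> \<longleftrightarrow> (v * y) * (inverse v * inverse y) \<in> herm_products"
      using \<open>v \<noteq> 0\<close> y by (intro herm_products_cancel[OF hS(1)]) simp
    also have "\<dots>"
    proof (cases "g = 0")
      case True
      then have "(v * y) * (inverse v * inverse y) = 1"
        using y by (simp add: v_def mult.assoc) (simp add: mult.assoc[symmetric])
      then show ?thesis using one_in_herm_products by simp
    next
      case g: False
      then have gS: "g \<in> herm_products" "inverse g \<in> herm_products"
        using 2(2) by (auto intro: herm herm_inverse simp: g_def)
      define w where "w = inverse g * y"
      define a where "a = w + 1"
      have y_eq: "y = g * w" using g by (simp add: w_def mult.assoc[symmetric])
      have v_eq: "v = g * a" by (simp add: v_def a_def y_eq distrib_left)
      have nz: "w \<noteq> 0" "a \<noteq> 0" using y y_eq \<open>v \<noteq> 0\<close> v_eq by auto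
      have "(v * y) * (inverse v * inverse y)
          = 1 * (g * (a * (g * (w * (inverse a * (inverse g * (inverse w * (inverse g * 1))))))))"
        unfolding y_eq v_eq using g nz by (simp add: nonzero_inverse_mult_distrib mult.assoc)
      also have "\<dots> \<in> herm_products \<longleftrightarrow>
          a * (g * (w * (inverse a * (inverse g * (inverse w * (inverse g * 1)))))) \<in> herm_products"
        using herm_products_cancel[OF gS(1), of 1] by simp
      also have "\<dots> \<longleftrightarrow> (a * w * inverse a) * (inverse g * (inverse w * (inverse g * 1))) \<in> herm_products"
        using herm_products_cancel[OF gS(1) nz(2)] by (simp add: mult.assoc)
      also have "\<dots> \<longleftrightarrow> (a * w * inverse a * inverse w) * (inverse g * 1) \<in> herm_products"
        using herm_products_cancel[OF gS(2), of "a * w * inverse a"] nz by (simp add: mult.assoc)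
      also have "\<dots> \<longleftrightarrow> a * w * inverse a * inverse w * 1 \<in> herm_products"
        using nz by (intro herm_products_cancel[OF gS(2)]) simp
      also have "a * w = w * a" by (simp add: a_def algebra_simps)
      also have "w * a * inverse a * inverse w * 1 = 1" using nz by (simp add: mult.assoc)
      finally show ?thesis using one_in_herm_products by simp
    qed
    finally show ?thesis by simp
  qed
qed

text \<open>If the commutators of \<open>a\<close> with \<open>b\<close> and with \<open>1 + b\<close> were both central, comparing them would give a
  linear relation between \<open>1\<close> and \<open>b\<close> over \<open>K\<close>.\<close>

lemma noncentral_commutator_exists:
  obtains a b where "a \<noteq> 0" "b \<noteq> 0" "a * b * inverse a * inverse b \<notin> range \<kappa>"
proof -
  obtain a where "a \<notin> range \<kappa>" using noncentral_exists by blast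
  then obtain b where ab: "a * b \<noteq> b * a" using in_range_\<kappa>_iff by blast
  have nz: "a \<noteq> 0" "b \<noteq> 0" using ab by auto
  have nz1: "1 + b \<noteq> 0"
  proof
    assume "1 + b = 0"
    then have "b = - 1" by (simp add: add_eq_0_iff)
    then show False using ab by simp
  qed
  have bc: "b \<notin> range \<kappa>" using ab in_range_\<kappa>_iff by metis
  have expand: "a * c = \<kappa> d * c * a" if "c \<noteq> 0" "a * c * inverse a * inverse c = \<kappa> d" for c d
  proof -
    have "\<kappa> d * c * a = a * c * inverse a * (inverse c * c) * a"
      unfolding that(2)[symmetric] by (simp add: mult.assoc)
    then show ?thesis using that(1) nz by (simp add: mult.assoc)
  qed
  have "\<not> (a * b * inverse a * inverse b \<in> range \<kappa> \<and> a * (1 + b) * inverse a * inverse (1 + b) \<in> range \<kappa>)"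
  proof
    assume *: "a * b * inverse a * inverse b \<in> range \<kappa> \<and> a * (1 + b) * inverse a * inverse (1 + b) \<in> range \<kappa>"
    then obtain d1 d2 where d: "a * b * inverse a * inverse b = \<kappa> d1"
      "a * (1 + b) * inverse a * inverse (1 + b) = \<kappa> d2" by blast
    have e1: "a * b = \<kappa> d1 * b * a" by (rule expand[OF nz(2) d(1)])
    have "a * (1 + b) = \<kappa> d2 * (1 + b) * a" by (rule expand[OF nz1 d(2)])
    then have "a + \<kappa> d1 * b * a = \<kappa> d2 * (1 + b) * a" by (simp add: distrib_left e1)
    then have "(\<kappa> (1 - d2) + \<kappa> (d1 - d2) * b + \<kappa> 0 * b\<^sup>2) * a = 0"
      by (simp add: algebra_simps)
    then have "\<kappa> (1 - d2) + \<kappa> (d1 - d2) * b + \<kappa> 0 * b\<^sup>2 = 0" using nz by simp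
    then have "d1 = 1" using quadratic_relation_trivial[OF bc] by fastforce
    then show False using e1 ab by simp
  qed
  then show thesis using that nz nz1 by blast
qed

text \<open>A central element of norm 1 is made noncentral by multiplying it with a noncentral
  commutator, which has norm 1.\<close>

theorem norm_one_in_herm_products:
  assumes n: "nrd \<kappa> p = 1"
  shows "p \<in> herm_products"
proof -
  have noncentral: "q \<in> herm_products" if "q \<notin> range \<kappa>" "nrd \<kappa> q = 1" for q
  proof -
    obtain x g where "x \<noteq> 0" "g \<noteq> 0" "q = x * g * inverse x * inverse g"
      using noncentral_norm_one_is_commutator[OF \<open>q \<notin> range \<kappa>\<close> \<open>nrd \<kappa> q = 1\<close>] .
    then show ?thesis using commutator_in_herm_products[of x g] by (simp add: mult.assoc)
  qed
  obtain a b where ab: "a \<noteq> 0" "b \<noteq> 0" "a * b * inverse a * inverse b \<notin> range \<kappa>"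
    using noncentral_commutator_exists .
  define q where "q = a * b * inverse a * inverse b"
  have "nrd \<kappa> q = (nrd \<kappa> a * nrd \<kappa> (inverse a)) * (nrd \<kappa> b * nrd \<kappa> (inverse b))"
    by (simp add: q_def nrd_mult ac_simps)
  then have q: "nrd \<kappa> q = 1" using nrd_inverse_mult ab by simp
  have qc: "q \<notin> range \<kappa>" using ab(3) by (simp add: q_def)
  show ?thesis
  proof (cases "p \<in> range \<kappa>")
    case True
    then obtain c where p: "p = \<kappa> c" by auto
    have "p \<noteq> 0" using n nrd_0 by auto
    have "p * q \<notin> range \<kappa>"
    proof
      assume "p * q \<in> range \<kappa>"
      then obtain d where "\<kappa> d = \<kappa> c * q" using p by auto
      then have "\<kappa> (inverse c * d) = \<kappa> (inverse c) * (\<kappa> c * q)" by simp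
      also have "\<dots> = \<kappa> (inverse c * c) * q" by (simp add: mult.assoc)
      also have "inverse c * c = 1" using \<open>p \<noteq> 0\<close> p by simp
      finally have "q = \<kappa> (inverse c * d)" by simp
      then show False using qc by blast
    qed
    then have "p * q \<in> herm_products" by (rule noncentral) (simp add: nrd_mult n q)
    moreover have "inverse q \<in> herm_products"
      by (intro herm_products_inverse noncentral qc q)
    ultimately have "p * q * inverse q \<in> herm_products" by (rule herm_products_mult)
    moreover have "q \<noteq> 0" using q nrd_0 by auto
    ultimately show ?thesis by (simp add: mult.assoc)
  next
    case False
    then show ?thesis by (rule noncentral[OF _ n])
  qed
qed

lemma bar_simps: "bar (x * y) = bar x * bar y" "bar (x + y) = bar x + bar y" "bar 1 = 1"
  using bar_hom by (auto simp: unital_ring_hom_def)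

lemma \<sigma>_in_range: "\<sigma> x \<in> range \<kappa> \<longleftrightarrow> x \<in> range \<kappa>"
  by (metis \<sigma>_\<kappa> \<sigma>_invol image_iff rangeI)

text \<open>The involution turns the characteristic polynomial of \<open>x\<close> into a polynomial relation for
  \<open>\<sigma> x\<close> with conjugated coefficients.\<close>

lemma nrd_\<sigma>: "nrd \<kappa> (\<sigma> x) = bar (nrd \<kappa> x)"
proof (cases "x \<in> range \<kappa>")
  case True
  then show ?thesis by (auto simp: \<sigma>_\<kappa> nrd_\<kappa> bar_simps)
next
  case False
  then have \<sigma>x: "\<sigma> x \<notin> range \<kappa>" by (simp add: \<sigma>_in_range)
  have "\<sigma> x ^ 3 = \<sigma> (x ^ 3)" by (simp add: power3_eq_cube \<sigma>_mult mult.assoc)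
  also have "\<dots> = \<kappa> (bar (trd \<kappa> x)) * (\<sigma> x)\<^sup>2 - \<kappa> (bar (srd \<kappa> x)) * \<sigma> x + \<kappa> (bar (nrd \<kappa> x))"
    unfolding cayley_hamilton[of x]
    by (simp add: \<sigma>_add \<sigma>_diff \<sigma>_mult \<sigma>_\<kappa> power2_eq_square \<kappa>_commute)
  finally have "det (rep (\<sigma> x)) = to_ac (bar (nrd \<kappa> x))"
    by (rule char_coeffs_noncentral(3)[OF scalar_hom_rep \<sigma>x])
  then show ?thesis by (simp flip: to_ac_nrd)
qed

lemma \<sigma>_adj: "\<sigma> (adj \<kappa> x) = adj \<kappa> (\<sigma> x)"
proof (cases "x = 0")
  case False
  then show ?thesis
    by (simp add: adj_eq \<sigma>_mult \<sigma>_\<kappa> nrd_\<sigma> \<sigma>_inverse \<kappa>_commute)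
qed (simp add: adj_0)

end

section \<open>The second Tits construction\<close>

context second_tits_construction
begin

lemma U_hermitian:
  assumes "h \<noteq> 0"
  shows "U (h, 0) (b0, b) = (h * b0 * h, \<kappa> (nrd \<kappa> h) * inverse h * b)"
proof -
  have adj_h: "J_adj (h, 0) = (adj \<kappa> h, 0)" by (simp add: J_adj_def adj_0)
  have "J_cross (adj \<kappa> h, 0) (b0, b)
      = (adj \<kappa> (adj \<kappa> h + b0) - adj \<kappa> (adj \<kappa> h) - adj \<kappa> b0, - (adj \<kappa> h * b))"
    by (simp add: J_cross_def J_adj_def adj_0 algebra_simps)
  moreover have "J_trace (h, 0) (b0, b) = trd \<kappa> (h * b0)"
    using bar_diff[of 0 0] by (simp add: J_trace_def trd_0)
  ultimately have "U (h, 0) (b0, b) = (\<kappa> (trd \<kappa> (h * b0)) * h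
      - (adj \<kappa> (adj \<kappa> h + b0) - adj \<kappa> (adj \<kappa> h) - adj \<kappa> b0), adj \<kappa> h * b)"
    by (simp add: U_def adj_h J_scale_def)
  then show ?thesis unfolding jordan_U_operator using adj_eq[OF assms] by simp
qed

text \<open>For \<open>w\<close> Hermitian this is the quadratic operator of \<open>(w, 0)\<close>; for \<open>w\<close> in \<open>SU\<close> it is the
  automorphism given by \<open>w\<close>.\<close>

definition twist :: "'b \<Rightarrow> 'b \<times> 'b \<Rightarrow> 'b \<times> 'b" where
  "twist w = (\<lambda>(a, b)\<in>J. (w * a * \<sigma> w, \<kappa> (nrd \<kappa> w) * inverse (\<sigma> w) * b))"

lemma twist_in_J: "x \<in> J \<Longrightarrow> twist w x \<in> J"
  by (auto simp: twist_def J_def Herm_def \<sigma>_mult \<sigma>_invol mult.assoc)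

lemma twist_mult:
  assumes "v \<noteq> 0" "w \<noteq> 0" "x \<in> J"
  shows "twist v (twist w x) = twist (v * w) x"
proof -
  obtain a b where x: "x = (a, b)" by (cases x)
  have J: "(w * a * \<sigma> w, \<kappa> (nrd \<kappa> w) * inverse (\<sigma> w) * b) \<in> J"
    using twist_in_J[OF assms(3), of w] assms(3) by (simp add: twist_def x)
  have "\<kappa> (nrd \<kappa> v) * inverse (\<sigma> v) * (\<kappa> (nrd \<kappa> w) * inverse (\<sigma> w) * b)
      = \<kappa> (nrd \<kappa> (v * w)) * inverse (\<sigma> (v * w)) * b"
    using assms(1,2) \<kappa>_left_commute[of "inverse (\<sigma> v)" "nrd \<kappa> w"]
    by (simp add: \<sigma>_mult nonzero_inverse_mult_distrib nrd_mult mult.assoc)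
  then show ?thesis using assms(3) J by (simp add: twist_def x \<sigma>_mult mult.assoc)
qed

lemma twist_1: "x \<in> J \<Longrightarrow> twist 1 x = x"
  by (cases x) (simp add: twist_def nrd_1)

lemma twist_Bij:
  assumes "w \<noteq> 0"
  shows "twist w \<in> Bij J"
proof -
  have "bij_betw (twist w) J J"
    by (rule bij_betwI[where g = "twist (inverse w)"])
      (use assms in \<open>auto simp: twist_in_J twist_mult twist_1\<close>)
  then show ?thesis by (simp add: Bij_def twist_def)
qed

lemma twist_Instr:
  assumes "w \<in> herm_products"
  shows "twist w \<in> Instr_J"
proof -
  have herm: "twist h \<in> Instr_J" if h: "h \<in> Herm \<sigma>" "h \<noteq> 0" for h
  proof -
    have "twist h = restrict (U (h, 0)) J"
      using h by (auto simp: twist_def restrict_def U_hermitian Herm_def fun_eq_iff)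
    moreover have "(h, 0) \<in> J" using h by (simp add: J_def)
    moreover have "J_norm (h, 0) \<noteq> 0"
      using h(2) by (simp add: J_norm_def nrd_0 trd_0 nrd_eq_0_iff)
    ultimately show ?thesis unfolding Instr_J_def by (auto intro!: generate.incl)
  qed
  show ?thesis using assms
  proof (induction rule: herm_products.induct)
    case (herm h)
    then show ?case by (rule \<open>\<And>h. h \<in> Herm \<sigma> \<Longrightarrow> h \<noteq> 0 \<Longrightarrow> twist h \<in> Instr_J\<close>)
  next
    case (mult h s)
    have s: "s \<noteq> 0" by (rule herm_products_nonzero[OF mult.hyps(3)])
    have "twist h \<otimes>\<^bsub>GL_J\<^esub> twist s \<in> Instr_J"
      using herm[OF mult.hyps(1,2)] mult.IH unfolding Instr_J_def by (rule generate.eng)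
    also have "twist h \<otimes>\<^bsub>GL_J\<^esub> twist s = compose J (twist h) (twist s)"
      using twist_Bij[OF mult.hyps(2)] twist_Bij[OF s] by (simp add: GL_J_def BijGroup_def)
    also have "\<dots> = twist (h * s)"
      using mult.hyps(2) s by (auto simp: compose_def restrict_def twist_mult twist_def[of "h * s"] fun_eq_iff)
    finally show ?case .
  qed
qed

lemma J_add: "x \<in> J \<Longrightarrow> y \<in> J \<Longrightarrow> x + y \<in> J"
  by (auto simp: J_def Herm_def \<sigma>_add)

lemma \<sigma>_\<iota>_scale: "\<sigma> (\<kappa> (\<iota> c) * a) = \<kappa> (\<iota> c) * \<sigma> a"
  by (simp add: \<sigma>_mult \<sigma>_\<kappa> bar_fixes_k \<kappa>_commute)

lemma J_scale_in_J: "x \<in> J \<Longrightarrow> J_scale (\<iota> c) x \<in> J"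
  by (auto simp: J_def Herm_def J_scale_def \<sigma>_\<iota>_scale)

lemma J_adj_in_J: "x \<in> J \<Longrightarrow> J_adj x \<in> J"
  by (auto simp: J_def Herm_def J_adj_def \<sigma>_diff \<sigma>_adj \<sigma>_mult \<sigma>_invol u_herm mult.assoc)

lemma SU_facts:
  assumes "p \<in> SU \<kappa> \<sigma>"
  shows "p \<noteq> 0" "\<sigma> p = inverse p" "nrd \<kappa> p = 1" "nrd \<kappa> (inverse p) = 1"
proof -
  have p: "p * \<sigma> p = 1" "nrd \<kappa> p = 1" using assms by (auto simp: SU_def)
  then show "p \<noteq> 0" "nrd \<kappa> p = 1" by auto
  show "\<sigma> p = inverse p" using inverse_unique[OF p(1)] by simp
  show "nrd \<kappa> (inverse p) = 1" using nrd_inverse_mult[OF \<open>p \<noteq> 0\<close>] p(2) by simp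
qed

lemma \<phi>_eq_twist:
  assumes "p \<in> SU \<kappa> \<sigma>"
  shows "\<phi> p = twist p"
  using SU_facts[OF assms] by (simp add: \<phi>_def twist_def)

lemma \<phi>_Aut:
  assumes p: "p \<in> SU \<kappa> \<sigma>"
  shows "\<phi> p \<in> Aut_J"
proof -
  note f = SU_facts[OF p]
  have \<phi>: "\<phi> p (a, b) = (p * a * inverse p, p * b)" if "(a, b) \<in> J" for a b
    using that f(2) by (simp add: \<phi>_def)
  have cancel: "inverse p * (p * w) = w" "p * (inverse p * w) = w" for w
    using f(1) by (simp_all add: mult.assoc[symmetric])
  have adj_p: "adj \<kappa> p = inverse p" "adj \<kappa> (inverse p) = p"
    using f adj_eq[of p] adj_eq[of "inverse p"] by simp_all
  have \<sigma>_p: "\<sigma> (p * w) = \<sigma> w * inverse p" for w by (simp add: \<sigma>_mult f(2))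
  have "\<phi> p \<in> carrier GL_J"
  proof -
    have "\<phi> p (x + y) = \<phi> p x + \<phi> p y" if "x \<in> J" "y \<in> J" for x y
    proof -
      obtain a b a' b' where x: "x = (a, b)" and y: "y = (a', b')" by (cases x, cases y)
      show ?thesis using that J_add[OF that] by (simp add: x y \<phi> algebra_simps)
    qed
    moreover have "\<phi> p (J_scale (\<iota> c) x) = J_scale (\<iota> c) (\<phi> p x)" if "x \<in> J" for c x
    proof -
      obtain a b where x: "x = (a, b)" by (cases x)
      show ?thesis using that J_scale_in_J[OF that, of c]
        by (simp add: x J_scale_def \<phi> mult.assoc \<kappa>_left_commute[of p])
    qed
    ultimately show ?thesis
      using twist_Bij[OF f(1)] by (simp add: GL_J_def \<phi>_eq_twist[OF p])
  qed
  moreover have "\<phi> p J_one = J_one"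
    using \<phi>[of 1 0] f(1) by (simp add: J_one_def J_def Herm_def)
  moreover have "J_norm (\<phi> p x) = J_norm x" if "x \<in> J" for x
  proof -
    obtain a b where x: "x = (a, b)" by (cases x)
    have "trd \<kappa> (p * a * inverse p * (p * b) * u * \<sigma> (p * b)) = trd \<kappa> (p * (a * b * u * \<sigma> b) * inverse p)"
      by (simp add: \<sigma>_p mult.assoc cancel)
    then show ?thesis using that f by (simp add: x \<phi> J_norm_def nrd_mult \<sigma>_p trd_conj)
  qed
  moreover have "\<phi> p (J_adj x) = J_adj (\<phi> p x)" if "x \<in> J" for x
  proof -
    obtain a b where x: "x = (a, b)" by (cases x)
    have J: "(adj \<kappa> a - b * u * \<sigma> b, \<kappa> (bar \<mu>) * adj \<kappa> (\<sigma> b) * inverse u - a * b) \<in> J"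
      using J_adj_in_J[OF that] by (simp add: x J_adj_def)
    have "\<phi> p (J_adj x) = (p * (adj \<kappa> a - b * u * \<sigma> b) * inverse p,
        p * (\<kappa> (bar \<mu>) * adj \<kappa> (\<sigma> b) * inverse u - a * b))"
      using \<phi>[OF J] by (simp add: x J_adj_def)
    then show ?thesis using that
      by (simp add: x \<phi> J_adj_def adj_mult adj_p \<sigma>_p cancel right_diff_distrib left_diff_distrib
          mult.assoc \<kappa>_left_commute[of p])
  qed
  moreover have "J_trace (\<phi> p x) (\<phi> p y) = J_trace x y" if "x \<in> J" "y \<in> J" for x y
  proof -
    obtain a b a' b' where x: "x = (a, b)" and y: "y = (a', b')" by (cases x, cases y)
    have "trd \<kappa> (p * a * inverse p * (p * a' * inverse p)) = trd \<kappa> (p * (a * a') * inverse p)"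
      "trd \<kappa> (p * b * u * \<sigma> (p * b')) = trd \<kappa> (p * (b * u * \<sigma> b') * inverse p)"
      by (simp_all add: \<sigma>_p mult.assoc cancel)
    then show ?thesis using that f(1) by (simp add: x y \<phi> J_trace_def trd_conj)
  qed
  ultimately show ?thesis by (simp add: Aut_J_def)
qed

theorem \<phi>_inner:
  assumes "p \<in> SU \<kappa> \<sigma>"
  shows "inner_automorphism (\<phi> p)"
  using \<phi>_Aut[OF assms] twist_Instr[OF norm_one_in_herm_products] SU_facts(3)[OF assms]
  by (simp add: inner_automorphism_def \<phi>_eq_twist[OF assms])

end

theorem corollary5p2:
  fixes \<iota> :: "'k::field \<Rightarrow> 'K::field" and bar :: "'K \<Rightarrow> 'K"
    and \<kappa> :: "'K \<Rightarrow> 'b::division_ring" and \<sigma> :: "'b \<Rightarrow> 'b"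
    and p u :: 'b and \<mu> :: 'K
  assumes "unitary_division_algebra \<iota> bar \<kappa> \<sigma>"
    and "p \<in> SU \<kappa> \<sigma>"
    and "second_tits_construction \<iota> bar \<kappa> \<sigma> u \<mu>"
  shows "second_tits_construction.inner_automorphism \<iota> bar \<kappa> \<sigma> u \<mu>
           (second_tits_construction.\<phi> \<sigma> p)"
  by (rule second_tits_construction.\<phi>_inner[OF assms(3,2)])

end
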